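(* Let $V$ be a (complex) Banach space and consider the equation $y'=\mu(t)y+f(t)$ with $\mu:\mathbb{R}\to\mathbb{C}$ and $f:\mathbb{R}\to V$. Put $g(s,t)=\exp\big(\int_s^t\mu(r)\,dr\big)$. Then the following assertions are valid. (i) Assume that $\mu\in AA(\mathbb{R},\mathbb{C})$ satisfies $M(\mathrm{Re}(\mu))\ne0$ and that $f\in AA(\mathbb{R},V)$. Then a solution $y$ of the equation is bounded if and only if $y\in AA(\mathbb{R},V)$; equivalently, the unique solution of the equation belonging to $AA(\mathbb{R},V)$ is given by $$y(t)=\begin{cases}\displaystyle\int_{-\infty}^tg(s,t)f(s)\,ds, & M(\mathrm{Re}(\mu))<0,\\[2mm] \displaystyle-\int_t^\infty g(s,t)f(s)\,ds, & M(\mathrm{Re}(\mu))>0.\end{cases}$$ (ii) Assume that $\mu(t)=ia(t)$ with $a\in AA(\mathbb{R},\mathbb{R})$ and $\int_0^ta(s)\,ds$ bounded, that $f\in AA(\mathbb{R},V)$, and that $V$ is a Bohl-Bohr Banach space. Then a solution $y$ of the equation is bounded if and only if $y$ belongs to $AA(\mathbb{R},V)$, and it is given by $$y(t)=\exp\Big(i\int_0^ta(r)\,dr\Big)v+\int_0^t\exp\Big(i\int_s^ta(r)\,dr\Big)f(s)\,ds,\qquad v\in V.$$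
   Context: For a Banach space $W$, $AA(\mathbb{R},W)$ is the set of almost automorphic functions: continuous $\psi:\mathbb{R}\to W$ such that every real sequence has a subsequence $\{\tau_n\}$ for which $\tilde\psi(t)=\lim_n\psi(t+\tau_n)$ and $\psi(t)=\lim_n\tilde\psi(t-\tau_n)$ (pointwise) for all $t\in\mathbb{R}$. A bounded continuous function $h$ is ergodic if the limit $M(h)=\lim_{T\to\infty}\frac1{2T}\int_{-T+\xi}^{T+\xi}h(s)\,ds$ exists uniformly with respect to $\xi\in\mathbb{R}$ and is independent of $\xi$; $M(h)$ is its mean. The mean $M$ is only defined for ergodic functions, so the hypothesis $M(\mathrm{Re}(\mu))\neq0$ includes that $\mathrm{Re}(\mu)$ is ergodic. A Banach space $V$ is a Bohl-Bohr Banach space if for every $f\in AA(\mathbb{R},V)$ the function $F(t)=\int_0^tf(s)\,ds$ is in $AA(\mathbb{R},V)$ if and only if it is bounded. *)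

theory Defs
  imports "HOL-Analysis.Analysis"
begin

text \<open>
  The distribution has no class of complex Banach spaces. The law \<open>1 *\<^sub>C x = x\<close> is not listed
  because it follows from \<open>scaleR_scaleC\<close>.
\<close>

class complex_normed_vector = real_normed_vector +
  fixes scaleC :: "complex \<Rightarrow> 'a \<Rightarrow> 'a" (infixr "*\<^sub>C" 75)
  assumes scaleC_add_right: "c *\<^sub>C (x + y) = c *\<^sub>C x + c *\<^sub>C y"
    and scaleC_add_left: "(c + d) *\<^sub>C x = c *\<^sub>C x + d *\<^sub>C x"
    and scaleC_scaleC: "c *\<^sub>C (d *\<^sub>C x) = (c * d) *\<^sub>C x"
    and scaleR_scaleC: "r *\<^sub>R x = complex_of_real r *\<^sub>C x"
    and norm_scaleC: "norm (c *\<^sub>C x) = cmod c * norm x"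

class complex_banach = complex_normed_vector + banach

instantiation complex :: complex_banach
begin

definition scaleC_complex :: "complex \<Rightarrow> complex \<Rightarrow> complex"
  where "scaleC_complex c x = c * x"

instance
  by standard (simp_all add: scaleC_complex_def algebra_simps norm_mult scaleR_conv_of_real)

end

text \<open>
  The oriented integral, with the usual sign for \<open>b < a\<close>. It is built on the
  Henstock--Kurzweil integral because the interval Lebesgue integral of the library is restricted
  to second-countable codomains, and the Banach spaces here need not be separable.
\<close>

definition oriented_integral :: "real \<Rightarrow> real \<Rightarrow> (real \<Rightarrow> 'a::real_normed_vector) \<Rightarrow> 'a"
  where "oriented_integral a b h =
    (if a \<le> b then integral {a..b} h else - integral {b..a} h)"

definition almost_automorphic :: "(real \<Rightarrow> 'a::banach) \<Rightarrow> bool"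
  where "almost_automorphic \<psi> \<longleftrightarrow>
    continuous_on UNIV \<psi> \<and>
    (\<forall>\<sigma> :: nat \<Rightarrow> real. \<exists>k :: nat \<Rightarrow> nat. strict_mono k \<and>
      (\<exists>\<phi> :: real \<Rightarrow> 'a. \<forall>t.
        (\<lambda>n. \<psi> (t + \<sigma> (k n))) \<longlonglongrightarrow> \<phi> t \<and>
        (\<lambda>n. \<phi> (t - \<sigma> (k n))) \<longlonglongrightarrow> \<psi> t))"

definition has_mean :: "(real \<Rightarrow> 'a::banach) \<Rightarrow> 'a \<Rightarrow> bool"
  where "has_mean h m \<longleftrightarrow>
    uniform_limit UNIV (\<lambda>T \<xi>. (1 / (2 * T)) *\<^sub>R integral {- T + \<xi>..T + \<xi>} h) (\<lambda>\<xi>. m) at_top"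

definition ergodic :: "(real \<Rightarrow> 'a::banach) \<Rightarrow> bool"
  where "ergodic h \<longleftrightarrow>
    continuous_on UNIV h \<and> bounded (range h) \<and> (\<exists>m. has_mean h m)"

text \<open>Only meaningful for ergodic functions.\<close>

definition mean :: "(real \<Rightarrow> 'a::banach) \<Rightarrow> 'a"
  where "mean h = (THE m. has_mean h m)"

text \<open>A property of the space, hence the type argument.\<close>

definition bohl_bohr_space :: "'a::banach itself \<Rightarrow> bool"
  where "bohl_bohr_space _ \<longleftrightarrow>
    (\<forall>f :: real \<Rightarrow> 'a. almost_automorphic f \<longrightarrow>
      (almost_automorphic (\<lambda>t. oriented_integral 0 t f) \<longleftrightarrow>
       bounded (range (\<lambda>t. oriented_integral 0 t f))))"

definition ode_solution ::
  "(real \<Rightarrow> complex) \<Rightarrow> (real \<Rightarrow> 'v::complex_banach) \<Rightarrow> (real \<Rightarrow> 'v) \<Rightarrow> bool"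
  where "ode_solution \<mu> f y \<longleftrightarrow>
    (\<forall>t. (y has_vector_derivative (\<mu> t *\<^sub>C y t + f t)) (at t))"

definition propagator :: "(real \<Rightarrow> complex) \<Rightarrow> real \<Rightarrow> real \<Rightarrow> complex"
  where "propagator \<mu> s t = exp (oriented_integral s t \<mu>)"

end

theory Submission
  imports Defs
begin

text \<open>
  If \<open>M(Re \<mu>) < 0\<close>, then \<open>|g(s,t)| \<le> C exp(-d(t - s))\<close> for \<open>s \<le> t\<close>, so a bounded solution is unique
  and is the limit of \<open>\<integral>\<^sub>a\<^sup>t g(s,t) f(s) ds\<close> as \<open>a \<rightarrow> -\<infinity>\<close>. For a bounded solution \<open>y\<close>, the difference of
  two translates solves the equation with right-hand side
  \<open>(\<mu>(s+u) - \<mu>(s+v)) y(s+v) + f(s+u) - f(s+v)\<close>, so up to a small error \<open>|y(t+u) - y(t+v)|\<close> is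
  controlled by the integral over a compact interval of \<open>|F(s+u) - F(s+v)|\<close> with \<open>F = (\<mu>, f)\<close>.
  Such an estimate transfers almost automorphy from \<open>F\<close> to \<open>y\<close> by dominated convergence. This is
  applied to scalar functions only: the pointwise limits of translates of \<open>f\<close> need not be continuous,
  and they are never integrated. The case \<open>M(Re \<mu>) > 0\<close> follows by reversing time. If \<open>\<mu> = i a\<close> and
  \<open>A\<close> is the bounded primitive of \<open>a\<close>, then \<open>exp(-i A) y\<close> is a primitive of the almost automorphic
  function \<open>exp(-i A) f\<close> and the Bohl--Bohr property applies.
\<close>

subsection \<open>Almost automorphic functions\<close>

lemma almost_automorphic_continuous:
  "almost_automorphic \<psi> \<Longrightarrow> continuous_on S \<psi>"
  unfolding almost_automorphic_def by (meson continuous_on_subset subset_UNIV)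

lemma almost_automorphicE:
  assumes "almost_automorphic \<psi>"
  obtains k \<phi> where "strict_mono (k :: nat \<Rightarrow> nat)"
    "\<And>t. (\<lambda>n. \<psi> (t + \<sigma> (k n))) \<longlonglongrightarrow> \<phi> t"
    "\<And>t. (\<lambda>n. \<phi> (t - \<sigma> (k n))) \<longlonglongrightarrow> \<psi> t"
  using assms unfolding almost_automorphic_def by meson

text \<open>Along a sequence on which the norm exceeds \<open>n\<close>, the definition evaluated at
  \<open>t = 0\<close> gives a convergent, hence bounded, subsequence, which is a
  contradiction.\<close>

lemma almost_automorphic_bounded:
  assumes "almost_automorphic \<psi>"
  shows "bounded (range \<psi>)"
proof (rule ccontr)
  assume "\<not> bounded (range \<psi>)"
  then have "\<exists>x. norm (\<psi> x) > real n" for n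
    by (force simp: bounded_iff not_le)
  then obtain \<sigma> where \<sigma>: "\<And>n. norm (\<psi> (\<sigma> n)) > real n" by metis
  obtain k \<phi> where k: "strict_mono (k :: nat \<Rightarrow> nat)"
    and "\<And>t. (\<lambda>n. \<psi> (t + \<sigma> (k n))) \<longlonglongrightarrow> \<phi> t"
    using almost_automorphicE[OF assms] by metis
  then have "(\<lambda>n. \<psi> (0 + \<sigma> (k n))) \<longlonglongrightarrow> \<phi> 0" by blast
  then have "Bseq (\<lambda>n. \<psi> (\<sigma> (k n)))"
    by (simp add: convergentI convergent_imp_Bseq)
  then obtain B where B: "\<And>n. norm (\<psi> (\<sigma> (k n))) \<le> B"
    by (auto simp: Bseq_def)
  obtain n :: nat where "real n > B" using reals_Archimedean2 by blast
  moreover have "real n \<le> real (k n)" using k strict_mono_imp_increasing by auto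
  ultimately show False using B[of n] \<sigma>[of "k n"] by linarith
qed

text \<open>A common subsequence is found by extracting one for \<open>f\<close> and then a further
  one for \<open>g\<close>. This allows the coefficient and the right-hand side of the equation to
  be treated as a single function.\<close>

lemma almost_automorphic_Pair:
  assumes f: "almost_automorphic f" and g: "almost_automorphic g"
  shows "almost_automorphic (\<lambda>t. (f t, g t))"
  unfolding almost_automorphic_def
proof (intro conjI allI)
  show "continuous_on UNIV (\<lambda>t. (f t, g t))"
    using f g by (intro continuous_on_Pair almost_automorphic_continuous)
next
  fix \<sigma> :: "nat \<Rightarrow> real"
  obtain k \<phi> where k: "strict_mono (k :: nat \<Rightarrow> nat)"
    and f1: "\<And>t. (\<lambda>n. f (t + \<sigma> (k n))) \<longlonglongrightarrow> \<phi> t"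
    and f2: "\<And>t. (\<lambda>n. \<phi> (t - \<sigma> (k n))) \<longlonglongrightarrow> f t"
    using almost_automorphicE[OF f] by metis
  obtain l \<eta> where l: "strict_mono (l :: nat \<Rightarrow> nat)"
    and g1: "\<And>t. (\<lambda>n. g (t + (\<sigma> \<circ> k) (l n))) \<longlonglongrightarrow> \<eta> t"
    and g2: "\<And>t. (\<lambda>n. \<eta> (t - (\<sigma> \<circ> k) (l n))) \<longlonglongrightarrow> g t"
    using almost_automorphicE[OF g] by metis
  have 1: "(\<lambda>n. f (t + \<sigma> (k (l n)))) \<longlonglongrightarrow> \<phi> t" for t
    using LIMSEQ_subseq_LIMSEQ[OF f1 l] by (simp add: o_def)
  have 2: "(\<lambda>n. \<phi> (t - \<sigma> (k (l n)))) \<longlonglongrightarrow> f t" for t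
    using LIMSEQ_subseq_LIMSEQ[OF f2 l] by (simp add: o_def)
  show "\<exists>k. strict_mono k \<and> (\<exists>\<phi>. \<forall>t.
      (\<lambda>n. (f (t + \<sigma> (k n)), g (t + \<sigma> (k n)))) \<longlonglongrightarrow> \<phi> t \<and>
      (\<lambda>n. \<phi> (t - \<sigma> (k n))) \<longlonglongrightarrow> (f t, g t))"
    using k l g1 g2
    by (intro exI[of _ "k \<circ> l"] conjI exI[of _ "\<lambda>t. (\<phi> t, \<eta> t)"] allI)
      (auto simp: strict_mono_o intro!: tendsto_Pair 1 2)
qed

lemma almost_automorphic_reflect:
  assumes "almost_automorphic \<psi>"
  shows "almost_automorphic (\<lambda>t. \<psi> (- t))"
  unfolding almost_automorphic_def
proof (intro conjI allI)
  show "continuous_on UNIV (\<lambda>t. \<psi> (- t))"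
    by (intro continuous_on_compose2[OF almost_automorphic_continuous[OF assms, of UNIV]])
      (auto intro!: continuous_intros)
next
  fix \<sigma> :: "nat \<Rightarrow> real"
  obtain k \<phi> where k: "strict_mono (k :: nat \<Rightarrow> nat)"
    and 1: "\<And>t. (\<lambda>n. \<psi> (t + - \<sigma> (k n))) \<longlonglongrightarrow> \<phi> t"
    and 2: "\<And>t. (\<lambda>n. \<phi> (t - - \<sigma> (k n))) \<longlonglongrightarrow> \<psi> t"
    using almost_automorphicE[OF assms, of "\<lambda>n. - \<sigma> n"] by metis
  show "\<exists>k. strict_mono k \<and> (\<exists>\<phi>. \<forall>t.
      (\<lambda>n. \<psi> (- (t + \<sigma> (k n)))) \<longlonglongrightarrow> \<phi> t \<and>
      (\<lambda>n. \<phi> (t - \<sigma> (k n))) \<longlonglongrightarrow> \<psi> (- t))"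
    using k 1[of "- _"] 2[of "- _"]
    by (intro exI[of _ k] conjI exI[of _ "\<lambda>t. \<phi> (- t)"] allI) (simp_all add: add.commute)
qed

section \<open>Transfer of almost automorphy through estimates of translates\<close>

text \<open>The pointwise term controls Lipschitz images of \<open>F\<close>; the integral term
  controls solutions of differential equations with data \<open>F\<close>. Only norms of differences
  are integrated, so no vector-valued limit function ever has to be.\<close>

definition displacement ::
  "(real \<Rightarrow> 'a::real_normed_vector) \<Rightarrow> real \<Rightarrow> real \<Rightarrow> real \<Rightarrow> real \<Rightarrow> real \<Rightarrow> real"
  where "displacement F t a b u v =
    norm (F (t + u) - F (t + v)) + integral {a..b} (\<lambda>s. norm (F (s + u) - F (s + v)))"

lemma continuous_on_shift:
  fixes F :: "real \<Rightarrow> 'a::topological_space"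
  assumes "continuous_on UNIV F"
  shows "continuous_on S (\<lambda>s. F (s + u))"
  by (intro continuous_on_compose2[OF assms]) (auto intro!: continuous_intros)

lemma integrable_norm_shift_diff:
  fixes F :: "real \<Rightarrow> 'a::real_normed_vector"
  assumes "continuous_on UNIV F"
  shows "(\<lambda>s. norm (F (s + u) - F (s + v))) integrable_on {a..b}"
  by (intro integrable_continuous_real continuous_intros continuous_on_shift assms)

text \<open>Both parts are dominated convergence with the constant bound \<open>2 * B\<close>. The
  first makes translates of a controlled function Cauchy; the second handles the way back, where
  \<open>m\<close> tends to infinity before \<open>n\<close>.\<close>

lemma displacement_limits:
  fixes F :: "real \<Rightarrow> 'a::banach"
  assumes F: "almost_automorphic F"
    and 1: "\<And>t. (\<lambda>n. F (t + \<tau> n)) \<longlonglongrightarrow> \<phi> t"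
    and 2: "\<And>t. (\<lambda>n. \<phi> (t - \<tau> n)) \<longlonglongrightarrow> F t"
  shows "\<exists>G. G \<longlonglongrightarrow> 0 \<and> (\<forall>n m. displacement F t a b (\<tau> n) (\<tau> m) \<le> G n + G m)"
    and "\<exists>R. R \<longlonglongrightarrow> 0 \<and> (\<forall>n. (\<lambda>m. displacement F t a b 0 (\<tau> m - \<tau> n)) \<longlonglongrightarrow> R n)"
proof -
  have F_cont: "continuous_on UNIV F" by (rule almost_automorphic_continuous[OF F])
  note int = integrable_norm_shift_diff[OF F_cont]
  obtain B where B: "\<And>t. norm (F t) \<le> B"
    using almost_automorphic_bounded[OF F] by (auto simp: bounded_iff)
  have B\<phi>: "norm (\<phi> t) \<le> B" for t
    by (rule Lim_bounded[OF tendsto_norm[OF 1[of t]], of 0]) (simp add: B)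
  have diff_le: "norm (norm (x - y)) \<le> 2 * B" if "norm x \<le> B" "norm y \<le> B" for x y :: 'a
    using norm_triangle_ineq4[of x y] that by simp
  have const: "(\<lambda>s::real. 2 * B) integrable_on {a..b}" by (rule integrable_const_ivl)

  \<comment> \<open>\<open>E n\<close> is the limit in \<open>m\<close> of the continuous functions
    \<open>norm (F (s + \<tau> n) - F (s + \<tau> m))\<close>. Dominated convergence therefore makes
    it integrable without any regularity of \<open>\<phi>\<close>.\<close>
  define E where "E n s = norm (F (s + \<tau> n) - \<phi> s)" for n s
  have E_int: "E n integrable_on {a..b}" for n
  proof (rule dominated_convergence(1)[OF int const])
    show "(\<lambda>m. norm (F (s + \<tau> n) - F (s + \<tau> m))) \<longlonglongrightarrow> E n s" for s
      unfolding E_def by (intro tendsto_intros 1)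
  qed (intro diff_le B)
  have "(\<lambda>n. integral {a..b} (E n)) \<longlonglongrightarrow> integral {a..b} (\<lambda>s. 0)"
  proof (rule dominated_convergence(2)[OF E_int const])
    show "norm (E n s) \<le> 2 * B" for n s
      unfolding E_def by (intro diff_le B B\<phi>)
    show "(\<lambda>n. E n s) \<longlonglongrightarrow> 0" for s
      unfolding E_def using 1[of s] by (simp add: LIM_zero tendsto_norm_zero)
  qed
  moreover have "(\<lambda>n. E n t) \<longlonglongrightarrow> 0"
    unfolding E_def using 1[of t] by (simp add: LIM_zero tendsto_norm_zero)
  ultimately have lim: "(\<lambda>n. E n t + integral {a..b} (E n)) \<longlonglongrightarrow> 0"
    using tendsto_add_zero by fastforce
  have tri: "norm (F (s + \<tau> n) - F (s + \<tau> m)) \<le> E n s + E m s" for n m s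
    unfolding E_def using norm_triangle_ineq4[of "F (s + \<tau> n) - \<phi> s" "F (s + \<tau> m) - \<phi> s"] by simp
  have tri_int: "integral {a..b} (\<lambda>s. norm (F (s + \<tau> n) - F (s + \<tau> m)))
      \<le> integral {a..b} (E n) + integral {a..b} (E m)" for n m
    unfolding integral_add[OF E_int E_int, symmetric]
    by (intro integral_le int integrable_add E_int tri)
  have "displacement F t a b (\<tau> n) (\<tau> m)
      \<le> (E n t + integral {a..b} (E n)) + (E m t + integral {a..b} (E m))" for n m
    unfolding displacement_def using tri[of t n m] tri_int[of n m] by linarith
  with lim show "\<exists>G. G \<longlonglongrightarrow> 0 \<and> (\<forall>n m. displacement F t a b (\<tau> n) (\<tau> m) \<le> G n + G m)"
    by blast

  \<comment> \<open>\<open>D n\<close> is the limit in \<open>m\<close> of the distance from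
    \<open>F s\<close> to \<open>F (s + (\<tau> m - \<tau> n))\<close>; it is integrable for the
    same reason as \<open>E n\<close>.\<close>
  define D where "D n s = norm (F s - \<phi> (s - \<tau> n))" for n s
  have shift: "(\<lambda>m. F (s + (\<tau> m - \<tau> n))) \<longlonglongrightarrow> \<phi> (s - \<tau> n)" for s n
    using 1[of "s - \<tau> n"] by (simp add: algebra_simps)
  have D_lim: "(\<lambda>m. norm (F (s + 0) - F (s + (\<tau> m - \<tau> n)))) \<longlonglongrightarrow> D n s" for s n
    unfolding D_def add_0_right by (intro tendsto_intros shift)
  have D_int: "D n integrable_on {a..b}" for n
    by (rule dominated_convergence(1)[OF int const _ D_lim]) (intro diff_le B)
  have D_int_lim: "(\<lambda>m. integral {a..b} (\<lambda>s. norm (F (s + 0) - F (s + (\<tau> m - \<tau> n)))))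
      \<longlonglongrightarrow> integral {a..b} (D n)" for n
    by (rule dominated_convergence(2)[OF int const _ D_lim]) (intro diff_le B)
  have D_zero: "(\<lambda>n. D n s) \<longlonglongrightarrow> 0" for s
  proof -
    have "(\<lambda>n. norm (F s - \<phi> (s - \<tau> n))) \<longlonglongrightarrow> norm (F s - F s)"
      by (intro tendsto_intros 2)
    then show ?thesis by (simp add: D_def)
  qed
  have "(\<lambda>n. integral {a..b} (D n)) \<longlonglongrightarrow> integral {a..b} (\<lambda>s. 0)"
    by (rule dominated_convergence(2)[OF D_int const _ D_zero]) (auto simp: D_def intro!: diff_le[simplified] B B\<phi>)
  then have "(\<lambda>n. D n t + integral {a..b} (D n)) \<longlonglongrightarrow> 0"
    using tendsto_add_zero[OF D_zero[of t]] by simp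
  moreover have "(\<lambda>m. displacement F t a b 0 (\<tau> m - \<tau> n)) \<longlonglongrightarrow> D n t + integral {a..b} (D n)" for n
    unfolding displacement_def by (intro tendsto_add D_lim D_int_lim)
  ultimately show
    "\<exists>R. R \<longlonglongrightarrow> 0 \<and> (\<forall>n. (\<lambda>m. displacement F t a b 0 (\<tau> m - \<tau> n)) \<longlonglongrightarrow> R n)"
    by blast
qed

text \<open>\<open>a\<close>, \<open>b\<close> and \<open>K\<close> may depend on \<open>t\<close>
  and \<open>e\<close>, but not on \<open>u\<close> and \<open>v\<close>. With \<open>u\<close>,
  \<open>v\<close> two terms of the sequence, the estimate gives Cauchy sequences and hence limits
  \<open>z\<close>; with \<open>u = 0\<close> and \<open>v = \<tau> m - \<tau> n\<close> and
  \<open>m\<close> tending to infinity, it bounds the distance from \<open>z (t - \<tau> n)\<close>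
  to \<open>y t\<close>.\<close>

lemma almost_automorphic_transfer:
  fixes F :: "real \<Rightarrow> 'a::banach" and y :: "real \<Rightarrow> 'b::banach"
  assumes F: "almost_automorphic F" and y: "continuous_on UNIV y"
    and est: "\<And>t e. 0 < e \<Longrightarrow> \<exists>a b K. 0 \<le> K \<and>
      (\<forall>u v. norm (y (t + u) - y (t + v)) \<le> e + K * displacement F t a b u v)"
  shows "almost_automorphic y"
  unfolding almost_automorphic_def
proof (intro conjI allI)
  show "continuous_on UNIV y" by (rule y)
next
  fix \<sigma> :: "nat \<Rightarrow> real"
  obtain k \<phi> where k: "strict_mono (k :: nat \<Rightarrow> nat)"
    and 1: "\<And>t. (\<lambda>n. F (t + \<sigma> (k n))) \<longlonglongrightarrow> \<phi> t"
    and 2: "\<And>t. (\<lambda>n. \<phi> (t - \<sigma> (k n))) \<longlonglongrightarrow> F t"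
    using almost_automorphicE[OF F] by metis
  define \<tau> where "\<tau> n = \<sigma> (k n)" for n
  note lims = displacement_limits[where \<tau> = \<tau>, OF F 1[folded \<tau>_def] 2[folded \<tau>_def]]
  have "Cauchy (\<lambda>n. y (t + \<tau> n))" for t
  proof (rule metric_CauchyI)
    fix e :: real assume "0 < e"
    then obtain a b K where K: "0 \<le> K"
      and le: "\<And>u v. norm (y (t + u) - y (t + v)) \<le> e / 2 + K * displacement F t a b u v"
      using est[of "e / 2" t] by auto
    obtain G where "G \<longlonglongrightarrow> 0" and G: "\<And>n m. displacement F t a b (\<tau> n) (\<tau> m) \<le> G n + G m"
      using lims(1)[of t a b] by blast
    then have "(\<lambda>n. K * G n) \<longlonglongrightarrow> K * 0" by (intro tendsto_intros)
    with \<open>0 < e\<close> have "eventually (\<lambda>n. K * G n < e / 4) sequentially"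
      by (intro order_tendstoD(2)[of _ 0]) simp_all
    then obtain N where N: "\<And>n. n \<ge> N \<Longrightarrow> K * G n < e / 4"
      by (auto simp: eventually_sequentially)
    have "dist (y (t + \<tau> m)) (y (t + \<tau> n)) < e" if "m \<ge> N" "n \<ge> N" for m n
    proof -
      have "norm (y (t + \<tau> m) - y (t + \<tau> n)) \<le> e / 2 + K * (G m + G n)"
        using le[of "\<tau> m" "\<tau> n"] mult_left_mono[OF G[of m n] K] by linarith
      also have "\<dots> < e" using N[OF that(1)] N[OF that(2)] by (simp add: algebra_simps)
      finally show ?thesis by (simp add: dist_norm)
    qed
    then show "\<exists>N. \<forall>m\<ge>N. \<forall>n\<ge>N. dist (y (t + \<tau> m)) (y (t + \<tau> n)) < e" by blast
  qed
  then obtain z where z: "\<And>t. (\<lambda>n. y (t + \<tau> n)) \<longlonglongrightarrow> z t"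
    unfolding Cauchy_convergent_iff convergent_def by metis
  have "(\<lambda>n. z (t - \<tau> n)) \<longlonglongrightarrow> y t" for t
  proof (rule metric_LIMSEQ_I)
    fix e :: real assume "0 < e"
    then obtain a b K where K: "0 \<le> K"
      and le: "\<And>u v. norm (y (t + u) - y (t + v)) \<le> e / 2 + K * displacement F t a b u v"
      using est[of "e / 2" t] by auto
    obtain R where "R \<longlonglongrightarrow> 0"
      and R: "\<And>n. (\<lambda>m. displacement F t a b 0 (\<tau> m - \<tau> n)) \<longlonglongrightarrow> R n"
      using lims(2)[of t a b] by blast
    then have "(\<lambda>n. K * R n) \<longlonglongrightarrow> K * 0" by (intro tendsto_intros)
    with \<open>0 < e\<close> have "eventually (\<lambda>n. K * R n < e / 2) sequentially"
      by (intro order_tendstoD(2)[of _ 0]) simp_all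
    then obtain N where N: "\<And>n. n \<ge> N \<Longrightarrow> K * R n < e / 2"
      by (auto simp: eventually_sequentially)
    have "dist (z (t - \<tau> n)) (y t) < e" if "n \<ge> N" for n
    proof -
      have "(\<lambda>m. y (t + (\<tau> m - \<tau> n))) \<longlonglongrightarrow> z (t - \<tau> n)"
        using z[of "t - \<tau> n"] by (simp add: algebra_simps)
      then have "(\<lambda>m. norm (y (t + 0) - y (t + (\<tau> m - \<tau> n)))) \<longlonglongrightarrow> norm (y t - z (t - \<tau> n))"
        unfolding add_0_right by (intro tendsto_intros)
      moreover have "(\<lambda>m. e / 2 + K * displacement F t a b 0 (\<tau> m - \<tau> n)) \<longlonglongrightarrow> e / 2 + K * R n"
        by (intro tendsto_intros R)
      ultimately have "norm (y t - z (t - \<tau> n)) \<le> e / 2 + K * R n"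
        by (rule LIMSEQ_le) (intro exI allI impI le)
      also have "\<dots> < e" using N[OF that] by simp
      finally show ?thesis by (simp add: dist_norm norm_minus_commute)
    qed
    then show "\<exists>N. \<forall>n\<ge>N. dist (z (t - \<tau> n)) (y t) < e" by blast
  qed
  with k z show "\<exists>k. strict_mono k \<and> (\<exists>\<phi>. \<forall>t.
      (\<lambda>n. y (t + \<sigma> (k n))) \<longlonglongrightarrow> \<phi> t \<and> (\<lambda>n. \<phi> (t - \<sigma> (k n))) \<longlonglongrightarrow> y t)"
    unfolding \<tau>_def by blast
qed

lemma displacement_ge:
  fixes F :: "real \<Rightarrow> 'a::banach"
  assumes "continuous_on UNIV F"
  shows "norm (F (t + u) - F (t + v)) \<le> displacement F t a b u v"
    and "integral {a..b} (\<lambda>s. norm (F (s + u) - F (s + v))) \<le> displacement F t a b u v"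
  unfolding displacement_def
  using integral_nonneg[OF integrable_norm_shift_diff[OF assms, of u v a b]] by auto

text \<open>The pointwise term of the displacement suffices here, so the interval is taken
  degenerate.\<close>

lemma almost_automorphic_lipschitz:
  fixes F :: "real \<Rightarrow> 'a::banach" and y :: "real \<Rightarrow> 'b::banach"
  assumes F: "almost_automorphic F" and y: "continuous_on UNIV y"
    and K: "0 \<le> K" and le: "\<And>s t. norm (y s - y t) \<le> K * norm (F s - F t)"
  shows "almost_automorphic y"
proof (rule almost_automorphic_transfer[OF F y])
  fix t e :: real assume "0 < e"
  have "norm (y (t + u) - y (t + v)) \<le> e + K * displacement F t 0 0 u v" for u v
    using le[of "t + u" "t + v"] \<open>0 < e\<close>
      mult_left_mono[OF displacement_ge(1)[OF almost_automorphic_continuous[OF F], of t u v 0 0] K]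
    by linarith
  with K show "\<exists>a b K. 0 \<le> K \<and>
      (\<forall>u v. norm (y (t + u) - y (t + v)) \<le> e + K * displacement F t a b u v)" by blast
qed

subsection \<open>The linear equation and its propagator\<close>

lemma bounded_bilinear_scaleC:
  "bounded_bilinear (scaleC :: complex \<Rightarrow> 'v \<Rightarrow> 'v::complex_normed_vector)"
proof
  fix r :: real and c d :: complex and x y :: 'v
  show "(c + d) *\<^sub>C x = c *\<^sub>C x + d *\<^sub>C x" by (rule scaleC_add_left)
  show "c *\<^sub>C (x + y) = c *\<^sub>C x + c *\<^sub>C y" by (rule scaleC_add_right)
  show "(r *\<^sub>R c) *\<^sub>C x = r *\<^sub>R (c *\<^sub>C x)"
    unfolding scaleR_conv_of_real[of r c] by (simp add: scaleR_scaleC scaleC_scaleC)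
  show "c *\<^sub>C (r *\<^sub>R x) = r *\<^sub>R (c *\<^sub>C x)"
    by (simp add: scaleR_scaleC scaleC_scaleC mult.commute)
next
  show "\<exists>K. \<forall>c (x :: 'v). norm (c *\<^sub>C x) \<le> norm c * norm x * K"
    by (intro exI[of _ 1]) (simp add: norm_scaleC)
qed

interpretation scaleC: bounded_bilinear
  "scaleC :: complex \<Rightarrow> 'v \<Rightarrow> 'v::complex_normed_vector"
  by (rule bounded_bilinear_scaleC)

lemma scaleC_one [simp]: "1 *\<^sub>C x = (x :: 'v::complex_normed_vector)"
  using scaleR_scaleC[of 1 x] by simp

lemma oriented_integral_has_vector_derivative:
  fixes h :: "real \<Rightarrow> 'a::banach"
  assumes h: "continuous_on UNIV h"
  shows "((\<lambda>t. oriented_integral c t h) has_vector_derivative h t) (at t)"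
proof -
  \<comment> \<open>A base point \<open>a\<close> to the left of both \<open>c\<close> and
    \<open>t\<close> turns the oriented integral near \<open>t\<close> into a difference of ordinary
    integrals; the margins of 1 put \<open>t\<close> in the interior of
    \<open>{a..b}\<close>.\<close>
  define a b where "a = min c t - 1" and "b = max c t + 1"
  have int: "h integrable_on {u..v}" for u v
    using h continuous_on_subset integrable_continuous_real by blast
  have eq: "oriented_integral c u h = integral {a..u} h - integral {a..c} h" if "a \<le> u" for u
  proof (cases "c \<le> u")
    case True
    then show ?thesis
      using Henstock_Kurzweil_Integration.integral_combine[of a c u h] int
      by (auto simp: oriented_integral_def a_def algebra_simps)
  next
    case False
    then show ?thesis
      using Henstock_Kurzweil_Integration.integral_combine[of a u c h] int that
      by (auto simp: oriented_integral_def algebra_simps)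
  qed
  have "((\<lambda>u. integral {a..u} h) has_vector_derivative h t) (at t within {a..b})"
    by (intro integral_has_vector_derivative continuous_on_subset[OF h]) (auto simp: a_def b_def)
  moreover have "at t within {a..b} = at t"
    by (rule at_within_interior) (auto simp: a_def b_def)
  ultimately have "((\<lambda>u. integral {a..u} h - integral {a..c} h) has_vector_derivative h t) (at t)"
    by (auto intro!: derivative_eq_intros)
  then show ?thesis
    by (rule has_vector_derivative_transform_within_open[where S = "{a<..}"])
      (auto simp: eq a_def)
qed

lemma oriented_integral_eq:
  fixes h :: "real \<Rightarrow> 'a::banach"
  assumes "\<And>t. (H has_vector_derivative h t) (at t)"
  shows "oriented_integral a b h = H b - H a"
proof -
  have "(h has_integral (H v - H u)) {u..v}" if "u \<le> v" for u v
    using that assms by (intro fundamental_theorem_of_calculus)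
      (auto intro: has_vector_derivative_at_within)
  then show ?thesis
    unfolding oriented_integral_def by (smt (verit) integral_unique minus_diff_eq)
qed

lemma propagator_eq:
  assumes "\<And>t. (M has_vector_derivative \<mu> t) (at t)"
  shows "propagator \<mu> s t = exp (M t - M s)"
  unfolding propagator_def by (simp add: oriented_integral_eq[OF assms])

text \<open>In the form \<open>exp (M t - M s)\<close> the composition law and both derivatives of
  the propagator reduce to rules for the exponential.\<close>

lemma propagator_antiderivative:
  assumes "continuous_on UNIV \<mu>"
  obtains M where "\<And>t. (M has_vector_derivative \<mu> t) (at t)"
    and "\<And>s t. propagator \<mu> s t = exp (M t - M s)"
  using oriented_integral_has_vector_derivative[OF assms] propagator_eq by metis

lemma propagator_refl [simp]: "propagator \<mu> t t = 1"
  by (simp add: propagator_def oriented_integral_def)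

lemma propagator_mult:
  assumes "continuous_on UNIV \<mu>"
  shows "propagator \<mu> s t * propagator \<mu> r s = propagator \<mu> r t"
  by (rule propagator_antiderivative[OF assms]) (simp add: mult_exp_exp)

lemma propagator_has_vector_derivative:
  assumes "continuous_on UNIV \<mu>"
  shows "((\<lambda>s. propagator \<mu> s t) has_vector_derivative - \<mu> s * propagator \<mu> s t) (at s)"
    and "((\<lambda>t. propagator \<mu> s t) has_vector_derivative \<mu> t * propagator \<mu> s t) (at t)"
proof -
  obtain M where M: "\<And>t. (M has_vector_derivative \<mu> t) (at t)"
    and eq: "\<And>s t. propagator \<mu> s t = exp (M t - M s)"
    using propagator_antiderivative[OF assms] by blast
  have "((\<lambda>s. M t - M s) has_vector_derivative - \<mu> s) (at s)"
    by (auto intro!: derivative_eq_intros M)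
  from field_vector_diff_chain_at[OF this DERIV_exp]
  show "((\<lambda>s. propagator \<mu> s t) has_vector_derivative - \<mu> s * propagator \<mu> s t) (at s)"
    by (simp add: eq o_def)
  have "((\<lambda>t. M t - M s) has_vector_derivative \<mu> t) (at t)"
    by (auto intro!: derivative_eq_intros M)
  from field_vector_diff_chain_at[OF this DERIV_exp]
  show "((\<lambda>t. propagator \<mu> s t) has_vector_derivative \<mu> t * propagator \<mu> s t) (at t)"
    by (simp add: eq o_def)
qed

lemma continuous_on_propagator:
  assumes "continuous_on UNIV \<mu>"
  shows "continuous_on UNIV (\<lambda>s. propagator \<mu> s t)"
  by (intro continuous_at_imp_continuous_on ballI
      has_vector_derivative_continuous[OF propagator_has_vector_derivative(1)[OF assms]])

lemma ode_solution_continuous: "ode_solution \<mu> f y \<Longrightarrow> continuous_on UNIV y"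
  unfolding ode_solution_def
  by (meson has_vector_derivative_continuous continuous_at_imp_continuous_on)

lemma ode_solution_diff:
  assumes "ode_solution \<mu> f y" and "ode_solution \<mu> g z"
  shows "ode_solution \<mu> (\<lambda>t. f t - g t) (\<lambda>t. y t - z t)"
  using assms unfolding ode_solution_def
  by (auto intro!: derivative_eq_intros simp: scaleC.diff_right)

text \<open>The propagator is an integrating factor: in the product rule the two terms with
  \<open>\<mu> s\<close> cancel.\<close>

lemma ode_solution_propagator_derivative:
  assumes "continuous_on UNIV \<mu>" and "ode_solution \<mu> f y"
  shows "((\<lambda>s. propagator \<mu> s t *\<^sub>C y s) has_vector_derivative propagator \<mu> s t *\<^sub>C f s) (at s)"
proof -
  have "(y has_vector_derivative (\<mu> s *\<^sub>C y s + f s)) (at s)"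
    using assms(2) by (simp add: ode_solution_def)
  from bounded_bilinear.has_vector_derivative
    [OF bounded_bilinear_scaleC propagator_has_vector_derivative(1)[OF assms(1)] this]
  show ?thesis
    by (simp add: scaleC.add_right scaleC_scaleC scaleC.minus_left mult.commute)
qed

lemma variation_of_constants:
  assumes "continuous_on UNIV \<mu>" and "ode_solution \<mu> f y"
  shows "oriented_integral a b (\<lambda>s. propagator \<mu> s t *\<^sub>C f s)
      = propagator \<mu> b t *\<^sub>C y b - propagator \<mu> a t *\<^sub>C y a"
  by (rule oriented_integral_eq[OF ode_solution_propagator_derivative[OF assms]])

text \<open>The endpoint \<open>t\<close> of the propagator is independent of the interval:
  \<open>b = t\<close> serves decay forward in time, \<open>a = t\<close> decay backward in time.
  Integrability comes from the fundamental theorem of calculus.\<close>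

lemma variation_of_constants_has_integral:
  assumes "continuous_on UNIV \<mu>" and "ode_solution \<mu> f y" and "a \<le> b"
  shows "((\<lambda>s. propagator \<mu> s t *\<^sub>C f s) has_integral
      (propagator \<mu> b t *\<^sub>C y b - propagator \<mu> a t *\<^sub>C y a)) {a..b}"
  using assms(3) ode_solution_propagator_derivative[OF assms(1,2)]
  by (intro fundamental_theorem_of_calculus) (auto intro: has_vector_derivative_at_within)

lemma ode_solution_homogeneous:
  assumes "continuous_on UNIV \<mu>" and "ode_solution \<mu> (\<lambda>t. 0) y"
  shows "y t = propagator \<mu> a t *\<^sub>C y a"
proof -
  have "oriented_integral a t (\<lambda>s. 0 :: 'a) = 0" by (simp add: oriented_integral_def)
  with variation_of_constants[OF assms, of a t t] show ?thesis by (simp add: scaleC.zero_right)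
qed

lemma ode_solution_exists:
  fixes f :: "real \<Rightarrow> 'v::complex_banach"
  assumes \<mu>: "continuous_on UNIV \<mu>" and f: "continuous_on UNIV f"
  obtains y where "ode_solution \<mu> f y" and "y a = v"
proof -
  \<comment> \<open>Variation of constants with the propagator at \<open>a\<close>: the product rule
    leaves \<open>propagator \<mu> a t * propagator \<mu> t a\<close>, which is 1, in front of
    \<open>f t\<close>.\<close>
  define P where "P t = oriented_integral a t (\<lambda>s. propagator \<mu> s a *\<^sub>C f s)" for t
  define y where "y t = propagator \<mu> a t *\<^sub>C (v + P t)" for t
  have "continuous_on UNIV (\<lambda>s. propagator \<mu> s a *\<^sub>C f s)"
    by (intro scaleC.continuous_on continuous_on_propagator \<mu> f)
  then have P: "(P has_vector_derivative propagator \<mu> t a *\<^sub>C f t) (at t)" for t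
    unfolding P_def by (rule oriented_integral_has_vector_derivative)
  have "((\<lambda>t. v + P t) has_vector_derivative propagator \<mu> t a *\<^sub>C f t) (at t)" for t
    by (auto intro!: derivative_eq_intros P)
  from bounded_bilinear.has_vector_derivative
    [OF bounded_bilinear_scaleC propagator_has_vector_derivative(2)[OF \<mu>, of a] this]
  have "ode_solution \<mu> f y"
    unfolding ode_solution_def y_def
    by (simp add: scaleC_scaleC propagator_mult[OF \<mu>] add.commute)
  moreover have "y a = v" by (simp add: y_def P_def oriented_integral_def)
  ultimately show ?thesis by (rule that)
qed

section \<open>Integrals over half-lines as limits of integrals over compact intervals\<close>

lemma unbounded_atMost: "\<not> bounded {..t::real}"
proof
  assume "bounded {..t}"
  then obtain B where "\<And>x. x \<le> t \<Longrightarrow> \<bar>x\<bar> \<le> B" by (auto simp: bounded_iff)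
  from this[of "- \<bar>t\<bar> - \<bar>B\<bar> - 1"] show False by linarith
qed

lemma unbounded_atLeast: "\<not> bounded {t::real..}"
proof
  assume "bounded {t..}"
  then obtain B where "\<And>x. t \<le> x \<Longrightarrow> \<bar>x\<bar> \<le> B" by (auto simp: bounded_iff)
  from this[of "\<bar>t\<bar> + \<bar>B\<bar> + 1"] show False by linarith
qed

lemma has_integral_atMost:
  fixes h :: "real \<Rightarrow> 'a::banach"
  assumes h: "\<And>a. a \<le> t \<Longrightarrow> (h has_integral I a) {a..t}" and I: "(I \<longlongrightarrow> L) at_bot"
  shows "(h has_integral L) {..t}"
proof -
  have "\<exists>B>0. \<forall>a b. ball 0 B \<subseteq> cbox a b \<longrightarrow>
      (\<exists>z. ((\<lambda>x. if x \<in> {..t} then h x else 0) has_integral z) (cbox a b) \<and> norm (z - L) < e)"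
    if "e > 0" for e
  proof -
    obtain N where N: "\<And>a. a \<le> N \<Longrightarrow> norm (I a - L) < e"
      using tendstoD[OF I \<open>e > 0\<close>] by (auto simp: eventually_at_bot_linorder dist_norm)
    have "\<exists>z. ((\<lambda>x. if x \<in> {..t} then h x else 0) has_integral z) (cbox a b) \<and> norm (z - L) < e"
      \<comment> \<open>The radius is chosen so that every box containing the ball starts to the
        left of both \<open>N\<close> and \<open>t\<close> and ends to the right of
        \<open>t\<close>; the integral over the box is then \<open>I a\<close> with
        \<open>a \<le> N\<close>.\<close>
      if "ball 0 (\<bar>N\<bar> + \<bar>t\<bar> + 1) \<subseteq> cbox a b" for a b :: real
    proof -
      have "- (\<bar>N\<bar> + \<bar>t\<bar>) \<in> cbox a b" "\<bar>N\<bar> + \<bar>t\<bar> \<in> cbox a b"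
        using that by (auto simp: subset_iff)
      then have ab: "a \<le> N" "a \<le> t" "t \<le> b" by auto
      have "((\<lambda>x. if x \<in> {a..t} then h x else 0) has_integral I a) {a..b}"
        using h[OF ab(2)] ab by (subst has_integral_restrict) auto
      then have "((\<lambda>x. if x \<in> {..t} then h x else 0) has_integral I a) (cbox a b)"
        unfolding cbox_interval by (rule has_integral_eq[rotated]) auto
      with N[OF ab(1)] show ?thesis by blast
    qed
    then show ?thesis by (intro exI[of _ "\<bar>N\<bar> + \<bar>t\<bar> + 1"]) auto
  qed
  \<comment> \<open>The half-line is not a compact interval, so \<open>has_integral_alt\<close>
    reduces to its clause on large boxes.\<close>
  moreover have "\<nexists>a b. {..t} = cbox a b"
    by (metis bounded_cbox unbounded_atMost)
  ultimately show ?thesis by (subst has_integral_alt) simp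
qed

lemma has_integral_atLeast:
  fixes h :: "real \<Rightarrow> 'a::banach"
  assumes h: "\<And>b. t \<le> b \<Longrightarrow> (h has_integral I b) {t..b}" and I: "(I \<longlongrightarrow> L) at_top"
  shows "(h has_integral L) {t..}"
proof -
  have "\<exists>B>0. \<forall>a b. ball 0 B \<subseteq> cbox a b \<longrightarrow>
      (\<exists>z. ((\<lambda>x. if x \<in> {t..} then h x else 0) has_integral z) (cbox a b) \<and> norm (z - L) < e)"
    if "e > 0" for e
  proof -
    obtain N where N: "\<And>b. N \<le> b \<Longrightarrow> norm (I b - L) < e"
      using tendstoD[OF I \<open>e > 0\<close>] by (auto simp: eventually_at_top_linorder dist_norm)
    have "\<exists>z. ((\<lambda>x. if x \<in> {t..} then h x else 0) has_integral z) (cbox a b) \<and> norm (z - L) < e"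
      if "ball 0 (\<bar>N\<bar> + \<bar>t\<bar> + 1) \<subseteq> cbox a b" for a b :: real
    proof -
      have "- (\<bar>N\<bar> + \<bar>t\<bar>) \<in> cbox a b" "\<bar>N\<bar> + \<bar>t\<bar> \<in> cbox a b"
        using that by (auto simp: subset_iff)
      then have ab: "N \<le> b" "t \<le> b" "a \<le> t" by auto
      have "((\<lambda>x. if x \<in> {t..b} then h x else 0) has_integral I b) {a..b}"
        using h[OF ab(2)] ab by (subst has_integral_restrict) auto
      then have "((\<lambda>x. if x \<in> {t..} then h x else 0) has_integral I b) (cbox a b)"
        unfolding cbox_interval by (rule has_integral_eq[rotated]) auto
      with N[OF ab(1)] show ?thesis by blast
    qed
    then show ?thesis by (intro exI[of _ "\<bar>N\<bar> + \<bar>t\<bar> + 1"]) auto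
  qed
  moreover have "\<nexists>a b. {t..} = cbox a b"
    by (metis bounded_cbox unbounded_atLeast)
  ultimately show ?thesis by (subst has_integral_alt) simp
qed

subsection \<open>Exponentially stable equations\<close>

lemma has_vector_derivative_shift_arg:
  assumes "(y has_vector_derivative D) (at (t + u))"
  shows "((\<lambda>s. y (s + u)) has_vector_derivative D) (at t)"
proof -
  have "((\<lambda>s. s + u) has_vector_derivative 1) (at t)"
    by (auto intro!: derivative_eq_intros)
  from vector_diff_chain_at[OF this assms] show ?thesis by (simp add: o_def)
qed

text \<open>This decay forward in time is what a negative mean of \<open>Re \<mu>\<close> provides.
  A positive mean leads to the same situation for the reversed coefficient
  \<open>\<lambda>t. - \<mu> (- t)\<close>.\<close>

locale exponentially_stable =
  fixes \<mu> :: "real \<Rightarrow> complex" and C d :: real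
  assumes continuous: "continuous_on UNIV \<mu>" and rate_pos: "0 < d"
    and decay: "\<And>s t. s \<le> t \<Longrightarrow> cmod (propagator \<mu> s t) \<le> C * exp (- d * (t - s))"
begin

lemma C_pos: "0 < C"
  using decay[of 0 0] by simp

lemma decay_le: "s \<le> t \<Longrightarrow> cmod (propagator \<mu> s t) \<le> C"
  by (rule order_trans[OF decay mult_right_le_one_le]) (use C_pos rate_pos in simp_all)

text \<open>The constants do not depend on \<open>u\<close>. This gives estimates uniform in the
  translation when differences of translated solutions are studied.\<close>

lemma shift: "exponentially_stable (\<lambda>t. \<mu> (t + u)) C d"
proof
  obtain M where M: "\<And>t. (M has_vector_derivative \<mu> t) (at t)"
    and eq: "\<And>s t. propagator \<mu> s t = exp (M t - M s)"
    using propagator_antiderivative[OF continuous] by blast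
  from propagator_eq[of "\<lambda>t. M (t + u)", OF has_vector_derivative_shift_arg[OF M]]
  have "propagator (\<lambda>t. \<mu> (t + u)) s t = propagator \<mu> (s + u) (t + u)" for s t
    by (simp add: eq)
  then show "cmod (propagator (\<lambda>t. \<mu> (t + u)) s t) \<le> C * exp (- d * (t - s))" if "s \<le> t" for s t
    using decay[of "s + u" "t + u"] that by simp
qed (auto intro: continuous_on_shift continuous rate_pos)

text \<open>Decay is kept only for the initial value. Under the integral the crude bound
  \<open>C\<close> is enough, because in the application the interval is fixed before the
  translations vary.\<close>

lemma solution_norm_le:
  assumes y: "ode_solution \<mu> f y" and f: "continuous_on UNIV f" and "a \<le> t"
  shows "norm (y t) \<le> C * exp (- d * (t - a)) * norm (y a) + C * integral {a..t} (\<lambda>s. norm (f s))"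
proof -
  note int = variation_of_constants_has_integral[OF continuous y \<open>a \<le> t\<close>, of t]
  have "norm (integral {a..t} (\<lambda>s. propagator \<mu> s t *\<^sub>C f s))
      \<le> integral {a..t} (\<lambda>s. C * norm (f s))"
  proof (rule Henstock_Kurzweil_Integration.integral_norm_bound_integral)
    show "(\<lambda>s. propagator \<mu> s t *\<^sub>C f s) integrable_on {a..t}" using int by blast
    show "(\<lambda>s. C * norm (f s)) integrable_on {a..t}"
      by (intro integrable_continuous_real continuous_intros continuous_on_subset[OF f]) auto
    show "norm (propagator \<mu> s t *\<^sub>C f s) \<le> C * norm (f s)" if "s \<in> {a..t}" for s
      unfolding norm_scaleC using that by (intro mult_right_mono decay_le) auto
  qed
  with integral_unique[OF int]
  have "norm (y t - propagator \<mu> a t *\<^sub>C y a) \<le> C * integral {a..t} (\<lambda>s. norm (f s))" by simp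
  moreover have "norm (propagator \<mu> a t *\<^sub>C y a) \<le> C * exp (- d * (t - a)) * norm (y a)"
    unfolding norm_scaleC by (intro mult_right_mono decay \<open>a \<le> t\<close>) simp
  ultimately show ?thesis
    using norm_triangle_ineq[of "y t - propagator \<mu> a t *\<^sub>C y a" "propagator \<mu> a t *\<^sub>C y a"]
    by simp
qed

text \<open>Here the decay is kept under the integral, which makes the bound independent of both
  \<open>a\<close> and \<open>t\<close>.\<close>

lemma solution_from_zero_norm_le:
  assumes y: "ode_solution \<mu> f y" and B: "\<And>s. norm (f s) \<le> B" and "y a = 0" "a \<le> t"
  shows "norm (y t) \<le> C * B / d"
proof -
  \<comment> \<open>\<open>P\<close> is an antiderivative in \<open>s\<close> of the bound for the
    integrand, with \<open>P t = C * B / d\<close> and \<open>P a\<close> nonnegative.\<close>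
  define P where "P s = C * B / d * exp (- d * (t - s))" for s
  have P: "(P has_vector_derivative C * exp (- d * (t - s)) * B) (at s)" for s
    unfolding P_def has_real_derivative_iff_has_vector_derivative[symmetric]
    using rate_pos by (auto intro!: derivative_eq_intros)
  have P_int: "((\<lambda>s. C * exp (- d * (t - s)) * B) has_integral (P t - P a)) {a..t}"
    using \<open>a \<le> t\<close> P by (intro fundamental_theorem_of_calculus)
      (auto intro: has_vector_derivative_at_within)
  note int = variation_of_constants_has_integral[OF continuous y \<open>a \<le> t\<close>, of t]
  have "norm (integral {a..t} (\<lambda>s. propagator \<mu> s t *\<^sub>C f s))
      \<le> integral {a..t} (\<lambda>s. C * exp (- d * (t - s)) * B)"
  proof (rule Henstock_Kurzweil_Integration.integral_norm_bound_integral)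
    show "(\<lambda>s. propagator \<mu> s t *\<^sub>C f s) integrable_on {a..t}" using int by blast
    show "(\<lambda>s. C * exp (- d * (t - s)) * B) integrable_on {a..t}" using P_int by blast
    show "norm (propagator \<mu> s t *\<^sub>C f s) \<le> C * exp (- d * (t - s)) * B" if "s \<in> {a..t}" for s
      unfolding norm_scaleC using that C_pos by (intro mult_mono decay B) auto
  qed
  with integral_unique[OF int] integral_unique[OF P_int] \<open>y a = 0\<close>
  have "norm (y t) \<le> P t - P a" by (simp add: scaleC.zero_right)
  moreover have "0 \<le> B" using B[of 0] norm_ge_zero order_trans by blast
  then have "0 \<le> P a" unfolding P_def using C_pos rate_pos by simp
  ultimately show ?thesis by (simp add: P_def)
qed

lemma exp_decay_at_bot: "((\<lambda>a. K * exp (- d * (t - a))) \<longlongrightarrow> 0) at_bot"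
proof -
  have "filterlim (\<lambda>a. - d * (t - a)) at_bot at_bot"
    unfolding filterlim_at_bot eventually_at_bot_linorder
  proof
    fix Z
    have "- d * (t - a) \<le> Z" if "a \<le> t + Z / d" for a
      using that rate_pos by (simp add: field_simps)
    then show "\<exists>N. \<forall>a\<le>N. - d * (t - a) \<le> Z" by blast
  qed
  then have "((\<lambda>a. exp (- d * (t - a))) \<longlongrightarrow> 0) at_bot"
    by (rule filterlim_compose[OF exp_at_bot])
  then show ?thesis by (rule tendsto_mult_right_zero)
qed

lemma bounded_solution_tail:
  fixes y :: "real \<Rightarrow> 'v::complex_banach"
  assumes "bounded (range y)"
  shows "((\<lambda>a. propagator \<mu> a t *\<^sub>C y a) \<longlongrightarrow> 0) at_bot"
proof -
  obtain Y where Y: "\<And>t. norm (y t) \<le> Y" using assms by (auto simp: bounded_iff)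
  show ?thesis
  proof (rule Lim_null_comparison[OF _ exp_decay_at_bot])
    have "norm (propagator \<mu> a t *\<^sub>C y a) \<le> C * Y * exp (- d * (t - a))" if "a \<le> t" for a
    proof -
      have "norm (propagator \<mu> a t *\<^sub>C y a) \<le> C * exp (- d * (t - a)) * Y"
        unfolding norm_scaleC using C_pos by (intro mult_mono decay that Y) auto
      then show ?thesis by (simp add: algebra_simps)
    qed
    then show "eventually (\<lambda>a. norm (propagator \<mu> a t *\<^sub>C y a) \<le> C * Y * exp (- d * (t - a))) at_bot"
      unfolding eventually_at_bot_linorder by blast
  qed
qed

text \<open>In the variation of constants formula on \<open>{a..t}\<close> the boundary term at
  \<open>a\<close> vanishes as \<open>a\<close> tends to minus infinity. In particular this
  determines the bounded solution uniquely.\<close>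

lemma bounded_solution_has_integral:
  fixes y :: "real \<Rightarrow> 'v::complex_banach"
  assumes "ode_solution \<mu> f y" and "bounded (range y)"
  shows "((\<lambda>s. propagator \<mu> s t *\<^sub>C f s) has_integral y t) {..t}"
proof (rule has_integral_atMost)
  show "((\<lambda>s. propagator \<mu> s t *\<^sub>C f s) has_integral (y t - propagator \<mu> a t *\<^sub>C y a)) {a..t}"
    if "a \<le> t" for a
    using variation_of_constants_has_integral[OF continuous assms(1) that, of t] by simp
  show "((\<lambda>a. y t - propagator \<mu> a t *\<^sub>C y a) \<longlongrightarrow> y t) at_bot"
    using tendsto_diff[OF tendsto_const bounded_solution_tail[OF assms(2), of t]] by simp
qed

text \<open>The solutions \<open>x n\<close> starting from zero at time \<open>- n\<close> are
  bounded by \<open>C * B / d\<close> from then on. Their values at 0 converge, and the solution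
  starting from the limit inherits the bound.\<close>

lemma bounded_solution_exists:
  fixes f :: "real \<Rightarrow> 'v::complex_banach"
  assumes f: "continuous_on UNIV f" and f_bounded: "bounded (range f)"
  obtains y where "ode_solution \<mu> f y" and "bounded (range y)"
proof -
  obtain B where B: "\<And>t. norm (f t) \<le> B" using f_bounded by (auto simp: bounded_iff)
  have "\<exists>x. ode_solution \<mu> f x \<and> x (- real n) = 0" for n
    using ode_solution_exists[OF continuous f] by metis
  then obtain x where x: "\<And>n. ode_solution \<mu> f (x n)" and x0: "\<And>n. x n (- real n) = 0"
    by metis
  have bound: "norm (x n t) \<le> C * B / d" if "- real n \<le> t" for n t
    using solution_from_zero_norm_le[OF x B x0 that] .
  have hom: "y t - z t = propagator \<mu> a t *\<^sub>C (y a - z a)"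
    if "ode_solution \<mu> f y" "ode_solution \<mu> f z" for y z t a
    using ode_solution_homogeneous[OF continuous, of "\<lambda>t. y t - z t"] ode_solution_diff[OF that]
    by simp
  \<comment> \<open>At time \<open>- n\<close> the solution \<open>x n\<close> is zero and
    \<open>x m\<close> has already started, so their difference is at most \<open>C * B / d\<close>
    there; it then decays until time 0.\<close>
  have diff: "norm (x n 0 - x m 0) \<le> C * (C * B / d) * exp (- d * (0 - (- real n)))" if "n \<le> m" for n m
  proof -
    have "x n 0 - x m 0 = propagator \<mu> (- real n) 0 *\<^sub>C (x n (- real n) - x m (- real n))"
      by (rule hom[OF x x])
    then have "norm (x n 0 - x m 0) = cmod (propagator \<mu> (- real n) 0) * norm (x m (- real n))"
      by (simp add: norm_scaleC x0)
    also have "\<dots> \<le> (C * exp (- d * (0 - (- real n)))) * (C * B / d)"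
      using that C_pos by (intro mult_mono decay bound) auto
    finally show ?thesis by (simp add: algebra_simps)
  qed
  have "filterlim (\<lambda>n. - real n) at_bot sequentially"
    by (simp add: filterlim_uminus_at_bot filterlim_real_sequentially)
  then have lim0: "(\<lambda>n. C * (C * B / d) * exp (- d * (0 - (- real n)))) \<longlonglongrightarrow> 0"
    by (rule filterlim_compose[OF exp_decay_at_bot])
  have "Cauchy (\<lambda>n. x n 0)"
  proof (rule CauchyI')
    fix e :: real assume "0 < e"
    then obtain N where N: "\<And>n. n \<ge> N \<Longrightarrow> C * (C * B / d) * exp (- d * (0 - (- real n))) < e"
      using order_tendstoD(2)[OF lim0] by (auto simp: eventually_sequentially)
    show "\<exists>N. \<forall>m\<ge>N. \<forall>n>m. dist (x m 0) (x n 0) < e"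
      unfolding dist_norm using diff N by (meson le_less_trans less_imp_le)
  qed
  then obtain c where c: "(\<lambda>n. x n 0) \<longlonglongrightarrow> c"
    unfolding Cauchy_convergent_iff convergent_def by blast
  obtain y where y: "ode_solution \<mu> f y" and "y 0 = c"
    using ode_solution_exists[OF continuous f] by metis
  have "norm (y t) \<le> C * B / d" for t
  proof -
    \<comment> \<open>Convergence at time 0 propagates to every \<open>t\<close>, because
      \<open>x n\<close> and \<open>y\<close> differ by a homogeneous solution.\<close>
    have "(\<lambda>n. y t + propagator \<mu> 0 t *\<^sub>C (x n 0 - c)) \<longlonglongrightarrow> y t + propagator \<mu> 0 t *\<^sub>C (c - c)"
      by (intro tendsto_intros scaleC.tendsto c)
    moreover have "y t + propagator \<mu> 0 t *\<^sub>C (x n 0 - c) = x n t" for n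
      using hom[OF x y, of n t 0] \<open>y 0 = c\<close> by (simp add: algebra_simps)
    ultimately have "(\<lambda>n. x n t) \<longlonglongrightarrow> y t" by (simp add: scaleC.zero_right)
    moreover have "\<forall>n\<ge>nat \<lceil>\<bar>t\<bar>\<rceil>. norm (x n t) \<le> C * B / d"
      by (intro allI impI bound) linarith
    ultimately show ?thesis by (intro Lim_bounded[OF tendsto_norm])
  qed
  then have "bounded (range y)" by (auto simp: bounded_iff)
  with y show ?thesis by (rule that)
qed

lemma bounded_solution_almost_automorphic:
  fixes f :: "real \<Rightarrow> 'v::complex_banach"
  assumes \<mu>: "almost_automorphic \<mu>" and f: "almost_automorphic f"
    and y: "ode_solution \<mu> f y" and y_bounded: "bounded (range y)"
  shows "almost_automorphic y"
proof -
  define F where "F t = (\<mu> t, f t)" for t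
  have F: "almost_automorphic F"
    unfolding F_def by (intro almost_automorphic_Pair \<mu> f)
  have F_cont: "continuous_on UNIV F" by (rule almost_automorphic_continuous[OF F])
  have f_cont: "continuous_on UNIV f" by (rule almost_automorphic_continuous[OF f])
  have y_cont: "continuous_on UNIV y" by (rule ode_solution_continuous[OF y])
  obtain Y where Y: "\<And>t. norm (y t) \<le> Y" using y_bounded by (auto simp: bounded_iff)
  then have "0 \<le> Y" using norm_ge_zero order_trans by blast
  show ?thesis
  proof (rule almost_automorphic_transfer[OF F y_cont])
    fix t e :: real assume "0 < e"
    \<comment> \<open>The starting time \<open>a\<close> depends only on \<open>t\<close> and
      \<open>e\<close>: the difference of two translates is at most \<open>2 * Y\<close> at time
      \<open>a\<close> and contributes less than \<open>e\<close> at time \<open>t\<close>.\<close>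
    then have "eventually (\<lambda>a. C * (2 * Y) * exp (- d * (t - a)) < e) at_bot"
      by (rule order_tendstoD(2)[OF exp_decay_at_bot])
    then have "eventually (\<lambda>a. C * (2 * Y) * exp (- d * (t - a)) < e \<and> a \<le> t) at_bot"
      using eventually_le_at_bot by (rule eventually_conj)
    then obtain a where a: "C * (2 * Y) * exp (- d * (t - a)) < e" "a \<le> t"
      by (auto simp: eventually_at_bot_linorder)
    have "norm (y (t + u) - y (t + v)) \<le> e + C * (Y + 1) * displacement F t a t u v" for u v
    proof -
      \<comment> \<open>Adding and subtracting \<open>\<mu> (s + u) *\<^sub>C y (s + v)\<close>
        shows that the difference of the translates solves the equation with coefficient
        \<open>\<mu> (s + u)\<close> and right-hand side \<open>r\<close>.\<close>
      define r where "r s = (\<mu> (s + u) - \<mu> (s + v)) *\<^sub>C y (s + v) + (f (s + u) - f (s + v))" for s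
      interpret shifted: exponentially_stable "\<lambda>t. \<mu> (t + u)" C d by (rule shift)
      have deriv: "((\<lambda>s. y (s + w)) has_vector_derivative (\<mu> (s + w) *\<^sub>C y (s + w) + f (s + w))) (at s)"
        for s w
        using y by (intro has_vector_derivative_shift_arg) (simp add: ode_solution_def)
      have sol: "ode_solution (\<lambda>t. \<mu> (t + u)) r (\<lambda>s. y (s + u) - y (s + v))"
        unfolding ode_solution_def r_def
        by (auto intro!: derivative_eq_intros deriv simp: scaleC.diff_right scaleC.diff_left)
      have r_cont: "continuous_on UNIV r"
        unfolding r_def
        by (intro continuous_intros scaleC.continuous_on continuous_on_shift continuous f_cont y_cont)
      \<comment> \<open>Each component of a pair is bounded by the norm of the pair; the coefficient
        difference contributes the factor \<open>Y\<close>, the difference of \<open>f\<close> the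
        factor 1.\<close>
      have r_le: "norm (r s) \<le> (Y + 1) * norm (F (s + u) - F (s + v))" for s
      proof -
        have "norm (r s) \<le> cmod (\<mu> (s + u) - \<mu> (s + v)) * Y + norm (f (s + u) - f (s + v))"
          unfolding r_def
          by (rule order_trans[OF norm_triangle_ineq])
            (auto simp: norm_scaleC intro!: mult_left_mono Y)
        also have "\<dots> \<le> norm (F (s + u) - F (s + v)) * Y + norm (F (s + u) - F (s + v))"
          using \<open>0 \<le> Y\<close>
          by (intro add_mono mult_right_mono) (auto simp: F_def norm_fst_le norm_snd_le)
        finally show ?thesis by (simp add: algebra_simps)
      qed
      have "norm (y (t + u) - y (t + v)) \<le>
          C * exp (- d * (t - a)) * norm (y (a + u) - y (a + v)) + C * integral {a..t} (\<lambda>s. norm (r s))"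
        by (rule shifted.solution_norm_le[OF sol r_cont a(2)])
      also have "\<dots> \<le> C * exp (- d * (t - a)) * (2 * Y) +
          C * ((Y + 1) * integral {a..t} (\<lambda>s. norm (F (s + u) - F (s + v))))"
      proof (intro add_mono mult_left_mono)
        show "norm (y (a + u) - y (a + v)) \<le> 2 * Y"
          using norm_triangle_ineq4[of "y (a + u)" "y (a + v)"] Y[of "a + u"] Y[of "a + v"] by linarith
        show "integral {a..t} (\<lambda>s. norm (r s)) \<le> (Y + 1) * integral {a..t} (\<lambda>s. norm (F (s + u) - F (s + v)))"
          unfolding Henstock_Kurzweil_Integration.integral_mult_right[symmetric]
          by (intro integral_le integrable_continuous_real continuous_intros r_le
              continuous_on_shift F_cont continuous_on_subset[OF r_cont]) auto
      qed (use C_pos in auto)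
      also have "\<dots> \<le> e + C * ((Y + 1) * displacement F t a t u v)"
        using a(1) C_pos \<open>0 \<le> Y\<close>
        by (intro add_mono mult_left_mono displacement_ge F_cont) (auto simp: algebra_simps)
      finally show ?thesis by (simp add: algebra_simps)
    qed
    moreover have "0 \<le> C * (Y + 1)" using C_pos \<open>0 \<le> Y\<close> by simp
    ultimately show "\<exists>a b K. 0 \<le> K \<and>
        (\<forall>u v. norm (y (t + u) - y (t + v)) \<le> e + K * displacement F t a b u v)" by blast
  qed
qed

end

subsection \<open>Nonzero mean and reversal of time\<close>

lemma mean_eq:
  assumes "has_mean h m"
  shows "mean h = m"
  unfolding mean_def
proof (rule the_equality[of "has_mean h", OF assms])
  fix m' assume "has_mean h m'"
  with assms show "m' = m"
    unfolding has_mean_def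
    by (meson UNIV_I tendsto_uniform_limitI tendsto_unique trivial_limit_at_top_linorder)
qed

lemma ergodic_has_mean: "ergodic h \<Longrightarrow> has_mean h (mean h)"
  unfolding ergodic_def using mean_eq by metis

text \<open>Reflection carries the window centred at \<open>\<xi>\<close> to the one centred at
  \<open>- \<xi>\<close>, so uniformity in the centre is preserved.\<close>

lemma has_mean_reflect:
  assumes "has_mean h m"
  shows "has_mean (\<lambda>t. - h (- t)) (- m)"
  unfolding has_mean_def
proof (rule uniform_limitI)
  fix e :: real assume "0 < e"
  with assms have "eventually (\<lambda>T. \<forall>\<xi>. dist ((1 / (2 * T)) *\<^sub>R integral {- T + \<xi>..T + \<xi>} h) m < e) at_top"
    unfolding has_mean_def by (auto dest: uniform_limitD)
  then show "eventually (\<lambda>T. \<forall>\<xi>\<in>UNIV.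
      dist ((1 / (2 * T)) *\<^sub>R integral {- T + \<xi>..T + \<xi>} (\<lambda>t. - h (- t))) (- m) < e) at_top"
  proof (rule eventually_mono, intro ballI)
    fix T \<xi> assume le: "\<forall>\<xi>. dist ((1 / (2 * T)) *\<^sub>R integral {- T + \<xi>..T + \<xi>} h) m < e"
    have "integral {- T + \<xi>..T + \<xi>} (\<lambda>t. - h (- t)) = - integral {- T + - \<xi>..T + - \<xi>} h"
      using Henstock_Kurzweil_Integration.integral_reflect_real[of "T + - \<xi>" "- T + - \<xi>" h]
      by (simp add: add.commute)
    with le[rule_format, of "- \<xi>"]
    show "dist ((1 / (2 * T)) *\<^sub>R integral {- T + \<xi>..T + \<xi>} (\<lambda>t. - h (- t))) (- m) < e"
      by (simp add: dist_minus)
  qed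
qed

lemma norm_propagator:
  assumes "continuous_on UNIV \<mu>" and "s \<le> t"
  shows "cmod (propagator \<mu> s t) = exp (integral {s..t} (\<lambda>r. Re (\<mu> r)))"
proof -
  have "\<mu> integrable_on {s..t}"
    using assms(1) continuous_on_subset integrable_continuous_real by blast
  then have "integral {s..t} (\<lambda>r. Re (\<mu> r)) = Re (integral {s..t} \<mu>)"
    using integral_linear[OF _ bounded_linear_Re] by (simp add: o_def)
  with assms(2) show ?thesis by (simp add: propagator_def oriented_integral_def)
qed

text \<open>Uniformity in the centre of the window bounds the integral of \<open>Re \<mu>\<close>
  over every sufficiently long interval by \<open>- d\<close> times its length. Short intervals cost
  at most a constant, which becomes the factor \<open>exp c\<close>.\<close>

lemma has_mean_negative_stable:
  assumes \<mu>: "continuous_on UNIV \<mu>" "bounded (range \<mu>)"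
    and m: "has_mean (\<lambda>t. Re (\<mu> t)) m" "m < 0"
  obtains C d where "exponentially_stable \<mu> C d"
proof -
  \<comment> \<open>Half of the mean is given away: an average within \<open>d\<close> of
    \<open>m = - 2 * d\<close> is below \<open>- d\<close>.\<close>
  define d where "d = - m / 2"
  have "0 < d" using m(2) by (simp add: d_def)
  obtain B where "\<And>t. cmod (\<mu> t) \<le> B" using \<mu>(2) by (auto simp: bounded_iff)
  then have B: "Re (\<mu> t) \<le> B" for t
    using complex_Re_le_cmod order_trans by blast
  have int: "(\<lambda>r. Re (\<mu> r)) integrable_on {s..t}" for s t
    by (intro integrable_continuous_real continuous_intros continuous_on_subset[OF \<mu>(1)]) auto
  have "eventually (\<lambda>T. \<forall>\<xi>\<in>UNIV.
      dist ((1 / (2 * T)) *\<^sub>R integral {- T + \<xi>..T + \<xi>} (\<lambda>t. Re (\<mu> t))) m < d) at_top"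
    using m(1) \<open>0 < d\<close> unfolding has_mean_def by (rule uniform_limitD)
  then obtain N where N: "\<And>T \<xi>. N \<le> T \<Longrightarrow>
      \<bar>(1 / (2 * T)) * integral {- T + \<xi>..T + \<xi>} (\<lambda>t. Re (\<mu> t)) - m\<bar> < d"
    unfolding eventually_at_top_linorder by (auto simp: dist_real_def)
  define T0 where "T0 = max N 1"
  \<comment> \<open>On intervals shorter than \<open>2 * T0\<close> this bounds the integral of
    \<open>Re \<mu>\<close> plus \<open>d\<close> times the length.\<close>
  define c where "c = (\<bar>B\<bar> + d) * (2 * T0)"
  have "0 \<le> c" using \<open>0 < d\<close> by (simp add: c_def T0_def)
  have le: "integral {s..t} (\<lambda>r. Re (\<mu> r)) \<le> c - d * (t - s)" if "s \<le> t" for s t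
  proof (cases "2 * T0 \<le> t - s")
    case True
    \<comment> \<open>The interval from \<open>s\<close> to \<open>t\<close> is the window of
      half-length \<open>T\<close> centred at \<open>(s + t) / 2\<close>.\<close>
    define T where "T = (t - s) / 2"
    have T: "N \<le> T" "0 < T" using True by (auto simp: T_def T0_def)
    have "- T + (s + t) / 2 = s" "T + (s + t) / 2 = t" by (auto simp: T_def field_simps)
    with N[OF T(1), of "(s + t) / 2"]
    have "(1 / (2 * T)) * integral {s..t} (\<lambda>r. Re (\<mu> r)) < - d"
      by (simp add: d_def abs_less_iff)
    then have "integral {s..t} (\<lambda>r. Re (\<mu> r)) < - d * (2 * T)"
      using T(2) by (simp add: field_simps)
    moreover have "2 * T = t - s" by (simp add: T_def)
    ultimately show ?thesis using \<open>0 \<le> c\<close> by simp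
  next
    case False
    have "integral {s..t} (\<lambda>r. Re (\<mu> r)) \<le> integral {s..t} (\<lambda>r. \<bar>B\<bar>)"
      by (intro integral_le int integrable_const_ivl) (use B in \<open>smt (verit)\<close>)
    then have "integral {s..t} (\<lambda>r. Re (\<mu> r)) + d * (t - s) \<le> (\<bar>B\<bar> + d) * (t - s)"
      using that by (simp add: algebra_simps)
    also have "\<dots> \<le> c" unfolding c_def using False \<open>0 < d\<close> by (intro mult_left_mono) auto
    finally show ?thesis by simp
  qed
  have "exponentially_stable \<mu> (exp c) d"
  proof
    show "cmod (propagator \<mu> s t) \<le> exp c * exp (- d * (t - s))" if "s \<le> t" for s t
      using le[OF that] by (simp add: norm_propagator[OF \<mu>(1) that] mult_exp_exp)
  qed (use \<mu> \<open>0 < d\<close> in auto)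
  then show ?thesis by (rule that)
qed

section \<open>Reversal of time for solutions and propagators\<close>

lemma almost_automorphic_uminus:
  assumes "almost_automorphic \<psi>"
  shows "almost_automorphic (\<lambda>t. - \<psi> t)"
proof (rule almost_automorphic_lipschitz[OF assms])
  show "continuous_on UNIV (\<lambda>t. - \<psi> t)"
    by (intro continuous_on_minus almost_automorphic_continuous assms)
  show "norm (- \<psi> s - - \<psi> t) \<le> 1 * norm (\<psi> s - \<psi> t)" for s t
    by (simp add: norm_minus_commute)
qed simp

lemma has_vector_derivative_reflect:
  assumes "(y has_vector_derivative D) (at (- t))"
  shows "((\<lambda>s. y (- s)) has_vector_derivative - D) (at t)"
proof -
  have "((\<lambda>s. - s) has_vector_derivative - 1) (at t)"
    by (auto intro!: derivative_eq_intros)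
  from vector_diff_chain_at[OF this assms] show ?thesis by (simp add: o_def)
qed

text \<open>Reflection of the data is an involution, so the converse is the same implication applied
  to the reflected data.\<close>

lemma ode_solution_reflect:
  "ode_solution (\<lambda>t. - \<mu> (- t)) (\<lambda>t. - f (- t)) (\<lambda>t. y (- t)) \<longleftrightarrow> ode_solution \<mu> f y"
proof -
  have imp: "ode_solution (\<lambda>t. - \<mu> (- t)) (\<lambda>t. - f (- t)) (\<lambda>t. y (- t))"
    if "ode_solution \<mu> f y" for \<mu> and f y :: "real \<Rightarrow> 'a"
    unfolding ode_solution_def
  proof
    fix t
    have "(y has_vector_derivative (\<mu> (- t) *\<^sub>C y (- t) + f (- t))) (at (- t))"
      using that by (simp add: ode_solution_def)
    from has_vector_derivative_reflect[OF this]
    show "((\<lambda>t. y (- t)) has_vector_derivative - \<mu> (- t) *\<^sub>C y (- t) + - f (- t)) (at t)"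
      by (simp add: scaleC.minus_left)
  qed
  from imp[of \<mu> f y] imp[of "\<lambda>t. - \<mu> (- t)" "\<lambda>t. - f (- t)" "\<lambda>t. y (- t)"] show ?thesis by auto
qed

lemma propagator_reflect:
  assumes "continuous_on UNIV \<mu>"
  shows "propagator (\<lambda>t. - \<mu> (- t)) s t = propagator \<mu> (- s) (- t)"
proof -
  obtain M where M: "\<And>t. (M has_vector_derivative \<mu> t) (at t)"
    and eq: "\<And>s t. propagator \<mu> s t = exp (M t - M s)"
    using propagator_antiderivative[OF assms] by blast
  from propagator_eq[of "\<lambda>t. M (- t)", OF has_vector_derivative_reflect[OF M]]
  show ?thesis by (simp add: eq)
qed

lemma tendsto_at_top_reflect:
  "(f \<longlongrightarrow> L) at_bot \<Longrightarrow> ((\<lambda>t::real. f (- t)) \<longlongrightarrow> L) at_top"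
  by (rule filterlim_compose[OF _ filterlim_uminus_at_bot_at_top])

lemma exponentially_stable_bounded_solutions:
  fixes f :: "real \<Rightarrow> 'v::complex_banach"
  assumes \<mu>: "almost_automorphic \<mu>" and f: "almost_automorphic f"
    and stable: "exponentially_stable \<mu> C d"
  shows "\<exists>y. ode_solution \<mu> f y \<and> bounded (range y)"
    and "ode_solution \<mu> f y \<Longrightarrow> bounded (range y) \<Longrightarrow>
      almost_automorphic y \<and> (\<forall>t. ((\<lambda>s. propagator \<mu> s t *\<^sub>C f s) has_integral y t) {..t})"
proof -
  interpret exponentially_stable \<mu> C d by (rule stable)
  show "\<exists>y. ode_solution \<mu> f y \<and> bounded (range y)"
    using bounded_solution_exists almost_automorphic_continuous[OF f] almost_automorphic_bounded[OF f]
    by metis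
  show "almost_automorphic y \<and> (\<forall>t. ((\<lambda>s. propagator \<mu> s t *\<^sub>C f s) has_integral y t) {..t})"
    if "ode_solution \<mu> f y" "bounded (range y)"
    using bounded_solution_almost_automorphic[OF \<mu> f that] bounded_solution_has_integral[OF that]
    by blast
qed

text \<open>Existence and almost automorphy are carried over from the reversed equation. The
  integral formula comes from variation of constants on \<open>{t..b}\<close>; reversal supplies
  only the vanishing of the boundary term at \<open>b\<close>.\<close>

lemma exponentially_unstable_bounded_solutions:
  fixes f :: "real \<Rightarrow> 'v::complex_banach"
  assumes \<mu>: "almost_automorphic \<mu>" and f: "almost_automorphic f"
    and stable: "exponentially_stable (\<lambda>t. - \<mu> (- t)) C d"
  shows "\<exists>y. ode_solution \<mu> f y \<and> bounded (range y)"
    and "ode_solution \<mu> f y \<Longrightarrow> bounded (range y) \<Longrightarrow>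
      almost_automorphic y \<and> (\<forall>t. ((\<lambda>s. propagator \<mu> s t *\<^sub>C f s) has_integral - y t) {t..})"
proof -
  note \<mu>_cont = almost_automorphic_continuous[OF \<mu>, of UNIV]
  note \<mu>' = almost_automorphic_uminus[OF almost_automorphic_reflect[OF \<mu>]]
  note f' = almost_automorphic_uminus[OF almost_automorphic_reflect[OF f]]
  have range: "range (\<lambda>t. z (- t)) = range z" for z :: "real \<Rightarrow> 'v"
    by (metis image_image surj_uminus)
  obtain x where x: "ode_solution (\<lambda>t. - \<mu> (- t)) (\<lambda>t. - f (- t)) x" "bounded (range x)"
    using exponentially_stable_bounded_solutions(1)[OF \<mu>' f' stable] by blast
  from ode_solution_reflect[of \<mu> f "\<lambda>t. x (- t)"] x range[of x]
  show "\<exists>y. ode_solution \<mu> f y \<and> bounded (range y)"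
    by (intro exI[of _ "\<lambda>t. x (- t)"]) simp
  show "almost_automorphic y \<and> (\<forall>t. ((\<lambda>s. propagator \<mu> s t *\<^sub>C f s) has_integral - y t) {t..})"
    if y: "ode_solution \<mu> f y" and y_bounded: "bounded (range y)"
  proof (intro conjI allI)
    have y': "ode_solution (\<lambda>t. - \<mu> (- t)) (\<lambda>t. - f (- t)) (\<lambda>t. y (- t))"
      using y by (simp add: ode_solution_reflect)
    have y'_bounded: "bounded (range (\<lambda>t. y (- t)))"
      using y_bounded by (simp add: range)
    have "almost_automorphic (\<lambda>t. y (- t))"
      using exponentially_stable_bounded_solutions(2)[OF \<mu>' f' stable y' y'_bounded] by blast
    from almost_automorphic_reflect[OF this] show "almost_automorphic y" by simp
    interpret exponentially_stable "\<lambda>t. - \<mu> (- t)" C d by (rule stable)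
    fix t
    show "((\<lambda>s. propagator \<mu> s t *\<^sub>C f s) has_integral - y t) {t..}"
    proof (rule has_integral_atLeast)
      show "((\<lambda>s. propagator \<mu> s t *\<^sub>C f s) has_integral (propagator \<mu> b t *\<^sub>C y b - y t)) {t..b}"
        if "t \<le> b" for b
        using variation_of_constants_has_integral[OF \<mu>_cont y that, of t] by simp
      from tendsto_at_top_reflect[OF bounded_solution_tail[OF y'_bounded, of "- t"]]
      have "((\<lambda>b. propagator \<mu> b t *\<^sub>C y b) \<longlongrightarrow> 0) at_top"
        by (simp add: propagator_reflect[OF \<mu>_cont])
      from tendsto_diff[OF this tendsto_const]
      show "((\<lambda>b. propagator \<mu> b t *\<^sub>C y b - y t) \<longlongrightarrow> - y t) at_top" by simp
    qed
  qed
qed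

subsection \<open>Imaginary coefficients and the Bohl--Bohr property\<close>

text \<open>On bounded sets the product is a Lipschitz function of the pair of its factors.\<close>

lemma almost_automorphic_scaleC:
  fixes f :: "real \<Rightarrow> 'v::complex_banach"
  assumes \<phi>: "almost_automorphic \<phi>" and f: "almost_automorphic f"
  shows "almost_automorphic (\<lambda>t. \<phi> t *\<^sub>C f t)"
proof -
  obtain A where A: "\<And>t. cmod (\<phi> t) \<le> A"
    using almost_automorphic_bounded[OF \<phi>] by (auto simp: bounded_iff)
  obtain B where B: "\<And>t. norm (f t) \<le> B"
    using almost_automorphic_bounded[OF f] by (auto simp: bounded_iff)
  have AB: "0 \<le> A" "0 \<le> B" using A B norm_ge_zero order_trans by blast+
  show ?thesis
  proof (rule almost_automorphic_lipschitz[OF almost_automorphic_Pair[OF \<phi> f]])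
    show "continuous_on UNIV (\<lambda>t. \<phi> t *\<^sub>C f t)"
      by (intro scaleC.continuous_on almost_automorphic_continuous \<phi> f)
    show "0 \<le> A + B" using AB by simp
    fix s t
    have "\<phi> s *\<^sub>C f s - \<phi> t *\<^sub>C f t = \<phi> s *\<^sub>C (f s - f t) + (\<phi> s - \<phi> t) *\<^sub>C f t"
      by (simp add: scaleC.diff_right scaleC.diff_left)
    then have "norm (\<phi> s *\<^sub>C f s - \<phi> t *\<^sub>C f t)
        \<le> cmod (\<phi> s) * norm (f s - f t) + cmod (\<phi> s - \<phi> t) * norm (f t)"
      by (metis norm_scaleC norm_triangle_ineq)
    also have "\<dots> \<le> A * norm ((\<phi> s, f s) - (\<phi> t, f t)) + norm ((\<phi> s, f s) - (\<phi> t, f t)) * B"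
      using AB by (intro add_mono mult_mono A B) (auto simp: norm_fst_le norm_snd_le)
    finally show "norm (\<phi> s *\<^sub>C f s - \<phi> t *\<^sub>C f t)
        \<le> (A + B) * norm ((\<phi> s, f s) - (\<phi> t, f t))"
      by (simp add: algebra_simps)
  qed
qed

lemma bounded_solution_nonzero_mean:
  fixes \<mu> :: "real \<Rightarrow> complex" and f :: "real \<Rightarrow> 'v::complex_banach"
  assumes \<mu>: "almost_automorphic \<mu>" and f: "almost_automorphic f"
    and erg: "ergodic (\<lambda>t. Re (\<mu> t))" and nonzero: "mean (\<lambda>t. Re (\<mu> t)) \<noteq> 0"
  shows "\<exists>y. ode_solution \<mu> f y \<and> bounded (range y)"
    and "ode_solution \<mu> f y \<Longrightarrow> bounded (range y) \<Longrightarrow> almost_automorphic y \<and>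
      (mean (\<lambda>t. Re (\<mu> t)) < 0 \<longrightarrow>
        (\<forall>t. ((\<lambda>s. propagator \<mu> s t *\<^sub>C f s) has_integral y t) {..t})) \<and>
      (mean (\<lambda>t. Re (\<mu> t)) > 0 \<longrightarrow>
        (\<forall>t. ((\<lambda>s. propagator \<mu> s t *\<^sub>C f s) has_integral - y t) {t..}))"
proof -
  note m = ergodic_has_mean[OF erg]
  have "(\<exists>y. ode_solution \<mu> f y \<and> bounded (range y)) \<and>
    (\<forall>y. ode_solution \<mu> f y \<longrightarrow> bounded (range y) \<longrightarrow> almost_automorphic y \<and>
      (mean (\<lambda>t. Re (\<mu> t)) < 0 \<longrightarrow>
        (\<forall>t. ((\<lambda>s. propagator \<mu> s t *\<^sub>C f s) has_integral y t) {..t})) \<and>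
      (mean (\<lambda>t. Re (\<mu> t)) > 0 \<longrightarrow>
        (\<forall>t. ((\<lambda>s. propagator \<mu> s t *\<^sub>C f s) has_integral - y t) {t..})))"
  proof (cases "mean (\<lambda>t. Re (\<mu> t)) < 0")
    case True
    obtain C d where "exponentially_stable \<mu> C d"
      using has_mean_negative_stable[OF almost_automorphic_continuous[OF \<mu>]
          almost_automorphic_bounded[OF \<mu>] m True] .
    from exponentially_stable_bounded_solutions[OF \<mu> f this] True show ?thesis by auto
  next
    case False
    note \<mu>' = almost_automorphic_uminus[OF almost_automorphic_reflect[OF \<mu>]]
    \<comment> \<open>The reversed coefficient has the opposite mean, which is negative in this
      case.\<close>
    have m': "has_mean (\<lambda>t. Re (- \<mu> (- t))) (- mean (\<lambda>t. Re (\<mu> t)))"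
      using has_mean_reflect[OF m] by simp
    obtain C d where "exponentially_stable (\<lambda>t. - \<mu> (- t)) C d"
      using has_mean_negative_stable[OF almost_automorphic_continuous[OF \<mu>']
          almost_automorphic_bounded[OF \<mu>'] m'] False nonzero by auto
    from exponentially_unstable_bounded_solutions[OF \<mu> f this] False show ?thesis by auto
  qed
  then show "\<exists>y. ode_solution \<mu> f y \<and> bounded (range y)"
    and "ode_solution \<mu> f y \<Longrightarrow> bounded (range y) \<Longrightarrow> almost_automorphic y \<and>
      (mean (\<lambda>t. Re (\<mu> t)) < 0 \<longrightarrow>
        (\<forall>t. ((\<lambda>s. propagator \<mu> s t *\<^sub>C f s) has_integral y t) {..t})) \<and>
      (mean (\<lambda>t. Re (\<mu> t)) > 0 \<longrightarrow>
        (\<forall>t. ((\<lambda>s. propagator \<mu> s t *\<^sub>C f s) has_integral - y t) {t..}))"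
    by auto
qed

text \<open>No separate proof of the Bohl--Bohr theorem for scalar functions is needed: multiply the scalar
  function by a fixed nonzero vector.\<close>

lemma bohl_bohr_space_real_integral:
  fixes v :: "'v::banach" and a :: "real \<Rightarrow> real"
  assumes V: "bohl_bohr_space TYPE('v)" and "v \<noteq> 0"
    and a: "almost_automorphic a" and bdd: "bounded (range (\<lambda>t. oriented_integral 0 t a))"
  shows "almost_automorphic (\<lambda>t. oriented_integral 0 t a)"
proof -
  define A where "A t = oriented_integral 0 t a" for t
  have a_cont: "continuous_on UNIV a" by (rule almost_automorphic_continuous[OF a])
  have A: "(A has_vector_derivative a t) (at t)" for t
    unfolding A_def by (rule oriented_integral_has_vector_derivative[OF a_cont])
  have A_cont: "continuous_on UNIV A"
    by (intro continuous_at_imp_continuous_on ballI has_vector_derivative_continuous[OF A])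
  have av: "almost_automorphic (\<lambda>t. a t *\<^sub>R v)"
  proof (rule almost_automorphic_lipschitz[OF a])
    show "norm (a s *\<^sub>R v - a t *\<^sub>R v) \<le> norm v * norm (a s - a t)" for s t
      by (simp flip: scaleR_diff_left)
  qed (auto intro!: continuous_intros a_cont)
  have "((\<lambda>t. A t *\<^sub>R v) has_vector_derivative a t *\<^sub>R v) (at t)" for t
    by (rule bounded_linear.has_vector_derivative[OF bounded_linear_scaleR_left A])
  from oriented_integral_eq[OF this]
  have eq: "oriented_integral 0 t (\<lambda>s. a s *\<^sub>R v) = A t *\<^sub>R v" for t
    by (simp add: A_def[of 0] oriented_integral_def)
  obtain B where "\<And>t. \<bar>A t\<bar> \<le> B" using bdd by (auto simp: bounded_iff A_def)
  then have "bounded (range (\<lambda>t. A t *\<^sub>R v))"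
    by (intro boundedI[of _ "B * norm v"]) (auto intro!: mult_right_mono)
  with V av have "almost_automorphic (\<lambda>t. A t *\<^sub>R v)"
    unfolding bohl_bohr_space_def by (auto simp: eq)
  then have "almost_automorphic A"
  proof (rule almost_automorphic_lipschitz[OF _ A_cont])
    show "norm (A s - A t) \<le> (1 / norm v) * norm (A s *\<^sub>R v - A t *\<^sub>R v)" for s t
      using \<open>v \<noteq> 0\<close> by (simp flip: scaleR_diff_left)
  qed simp
  then show ?thesis by (simp add: A_def[abs_def])
qed

text \<open>The chord between two points of the unit circle has length
  \<open>2 * \<bar>sin ((x - y) / 2)\<bar>\<close>, at most the difference of the angles.\<close>

lemma norm_exp_ii_diff_le:
  "cmod (exp (\<i> * complex_of_real x) - exp (\<i> * complex_of_real y)) \<le> \<bar>x - y\<bar>"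
proof -
  have "exp (\<i> * complex_of_real x) = exp (\<i> * complex_of_real y) * exp (\<i> * complex_of_real (x - y))"
    by (simp add: mult_exp_exp algebra_simps)
  then have "exp (\<i> * complex_of_real x) - exp (\<i> * complex_of_real y)
      = exp (\<i> * complex_of_real y) * (exp (\<i> * complex_of_real (x - y)) - 1)"
    by (simp only: right_diff_distrib mult_1_right)
  then have "cmod (exp (\<i> * complex_of_real x) - exp (\<i> * complex_of_real y))
      = 2 * \<bar>sin ((x - y) / 2)\<bar>"
    by (simp only: norm_mult norm_exp_i_times dist_exp_i_1 mult_1_left)
  then show ?thesis using abs_sin_x_le_abs_x[of "(x - y) / 2"] by simp
qed

lemma almost_automorphic_exp_ii:
  assumes "almost_automorphic A"
  shows "almost_automorphic (\<lambda>t. exp (\<i> * complex_of_real (A t)))"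
proof (rule almost_automorphic_lipschitz[OF assms])
  show "cmod (exp (\<i> * complex_of_real (A s)) - exp (\<i> * complex_of_real (A t)))
      \<le> 1 * norm (A s - A t)" for s t
    using norm_exp_ii_diff_le by simp
  show "continuous_on UNIV (\<lambda>t. exp (\<i> * complex_of_real (A t)))"
    by (intro continuous_intros almost_automorphic_continuous assms)
qed simp

lemma propagator_imaginary:
  assumes "\<And>t. \<mu> t = \<i> * complex_of_real (a t)" and a: "continuous_on UNIV a"
  shows "propagator \<mu> s t = exp (\<i> * complex_of_real (oriented_integral s t a))"
proof -
  define A where "A t = oriented_integral 0 t a" for t
  have A: "(A has_vector_derivative a t) (at t)" for t
    unfolding A_def by (rule oriented_integral_has_vector_derivative[OF a])
  have "((\<lambda>t. \<i> * complex_of_real (A t)) has_vector_derivative \<mu> t) (at t)" for t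
    unfolding assms(1)
    by (intro has_vector_derivative_mult_right has_vector_derivative_of_real)
      (simp add: has_real_derivative_iff_has_vector_derivative A)
  from propagator_eq[OF this] show ?thesis
    by (simp add: oriented_integral_eq[OF A] right_diff_distrib)
qed

lemma bounded_solution_imaginary_almost_automorphic:
  fixes \<mu> :: "real \<Rightarrow> complex" and f :: "real \<Rightarrow> 'v::complex_banach"
  assumes \<mu>: "\<And>t. \<mu> t = \<i> * complex_of_real (a t)" and a: "almost_automorphic a"
    and bdd: "bounded (range (\<lambda>t. oriented_integral 0 t a))"
    and f: "almost_automorphic f" and V: "bohl_bohr_space TYPE('v)"
    and y: "ode_solution \<mu> f y" and y_bounded: "bounded (range y)"
  shows "almost_automorphic y"
\<comment> \<open>The integral of \<open>a\<close> is shown to be almost automorphic by means of a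
  nonzero vector. In the zero space \<open>y\<close> is constant.\<close>
proof (cases "\<exists>v :: 'v. v \<noteq> 0")
  case False
  then have "y s = y t" for s t by metis
  then show ?thesis
    using ode_solution_continuous[OF y] by (intro almost_automorphic_lipschitz[OF f, of y 0]) auto
next
  case True
  then obtain v :: 'v where "v \<noteq> 0" by blast
  define A where "A t = oriented_integral 0 t a" for t
  have a_cont: "continuous_on UNIV a" by (rule almost_automorphic_continuous[OF a])
  have "\<mu> = (\<lambda>t. \<i> * complex_of_real (a t))" by (rule ext) (rule \<mu>)
  then have \<mu>_cont: "continuous_on UNIV \<mu>"
    using a_cont by (auto intro!: continuous_intros)
  have A: "almost_automorphic A"
    unfolding A_def by (rule bohl_bohr_space_real_integral[OF V \<open>v \<noteq> 0\<close> a bdd])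
  have A_neg: "almost_automorphic (\<lambda>t. - A t)"
    by (rule almost_automorphic_uminus[OF A])
  have A_deriv: "(A has_vector_derivative a t) (at t)" for t
    unfolding A_def by (rule oriented_integral_has_vector_derivative[OF a_cont])
  have prop_eq: "propagator \<mu> s t = exp (\<i> * complex_of_real (A t - A s))" for s t
    using propagator_imaginary[OF \<mu> a_cont, of s t] oriented_integral_eq[OF A_deriv, of s t] by simp
  have A0: "A 0 = 0" by (simp add: A_def oriented_integral_def)
  have to_w: "almost_automorphic (\<lambda>t. propagator \<mu> t 0)"
    using almost_automorphic_exp_ii[OF A_neg] by (simp add: prop_eq A0)
  have from_w: "almost_automorphic (\<lambda>t. propagator \<mu> 0 t)"
    using almost_automorphic_exp_ii[OF A] by (simp add: prop_eq A0)
  \<comment> \<open>The integrating factor removes the coefficient: \<open>w t - w 0\<close> is the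
    integral of \<open>propagator \<mu> s 0 *\<^sub>C f s\<close>. The factor has modulus 1, so
    \<open>w\<close> is bounded together with \<open>y\<close>.\<close>
  define w where "w t = propagator \<mu> t 0 *\<^sub>C y t" for t
  have norm_w: "norm (w t) = norm (y t)" for t
    by (simp add: w_def norm_scaleC prop_eq)
  have w_int: "oriented_integral 0 t (\<lambda>s. propagator \<mu> s 0 *\<^sub>C f s) = w t - w 0" for t
    unfolding w_def by (rule variation_of_constants[OF \<mu>_cont y])
  obtain Y where Y: "\<And>t. norm (y t) \<le> Y" using y_bounded by (auto simp: bounded_iff)
  have "bounded (range (\<lambda>t. w t - w 0))"
  proof (rule boundedI, clarify)
    show "norm (w t - w 0) \<le> Y + Y" for t
      using norm_triangle_ineq4[of "w t" "w 0"] Y[of t] Y[of 0] by (simp add: norm_w)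
  qed
  with V almost_automorphic_scaleC[OF to_w f]
  have "almost_automorphic (\<lambda>t. w t - w 0)"
    unfolding bohl_bohr_space_def by (metis (no_types, lifting) w_int ext)
  then have "almost_automorphic w"
  proof (rule almost_automorphic_lipschitz)
    show "continuous_on UNIV w"
      unfolding w_def
      by (intro scaleC.continuous_on continuous_on_propagator \<mu>_cont ode_solution_continuous[OF y])
    show "norm (w s - w t) \<le> 1 * norm ((w s - w 0) - (w t - w 0))" for s t by simp
  qed simp
  from almost_automorphic_scaleC[OF from_w this] show ?thesis
    by (simp add: w_def scaleC_scaleC propagator_mult[OF \<mu>_cont])
qed

section \<open>Both assertions assembled\<close>

theorem theorem3p1:
  fixes \<mu> :: "real \<Rightarrow> complex" and f :: "real \<Rightarrow> 'v::complex_banach"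
  shows
    "(almost_automorphic \<mu> \<and> ergodic (\<lambda>t. Re (\<mu> t)) \<and> mean (\<lambda>t. Re (\<mu> t)) \<noteq> 0 \<and>
      almost_automorphic f \<longrightarrow>
        (\<forall>y. ode_solution \<mu> f y \<longrightarrow> (bounded (range y) \<longleftrightarrow> almost_automorphic y)) \<and>
        (\<exists>!y. ode_solution \<mu> f y \<and> almost_automorphic y) \<and>
        (\<forall>y. ode_solution \<mu> f y \<and> almost_automorphic y \<longrightarrow>
          (mean (\<lambda>t. Re (\<mu> t)) < 0 \<longrightarrow>
            (\<forall>t. (\<lambda>s. propagator \<mu> s t *\<^sub>C f s) integrable_on {..t} \<and>
                 y t = integral {..t} (\<lambda>s. propagator \<mu> s t *\<^sub>C f s))) \<and>
          (mean (\<lambda>t. Re (\<mu> t)) > 0 \<longrightarrow>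
            (\<forall>t. (\<lambda>s. propagator \<mu> s t *\<^sub>C f s) integrable_on {t..} \<and>
                 y t = - integral {t..} (\<lambda>s. propagator \<mu> s t *\<^sub>C f s)))))
     \<and>
     (\<forall>a :: real \<Rightarrow> real.
        (\<forall>t. \<mu> t = \<i> * complex_of_real (a t)) \<and> almost_automorphic a \<and>
        bounded (range (\<lambda>t. oriented_integral 0 t a)) \<and>
        almost_automorphic f \<and> bohl_bohr_space TYPE('v) \<longrightarrow>
          (\<forall>y. ode_solution \<mu> f y \<longrightarrow> (bounded (range y) \<longleftrightarrow> almost_automorphic y)) \<and>
          (\<forall>y. ode_solution \<mu> f y \<longleftrightarrow>
            (\<exists>v. \<forall>t. y t =
              exp (\<i> * complex_of_real (oriented_integral 0 t a)) *\<^sub>C v +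
              oriented_integral 0 t
                (\<lambda>s. exp (\<i> * complex_of_real (oriented_integral s t a)) *\<^sub>C f s))))"
proof (rule conjI; (intro allI)?; rule impI; elim conjE)
  assume \<mu>: "almost_automorphic \<mu>" and erg: "ergodic (\<lambda>t. Re (\<mu> t))"
    and nonzero: "mean (\<lambda>t. Re (\<mu> t)) \<noteq> 0" and f: "almost_automorphic f"
  let ?m = "mean (\<lambda>t. Re (\<mu> t))"
  note part1 = bounded_solution_nonzero_mean[OF \<mu> f erg nonzero]
  have iff: "bounded (range y) \<longleftrightarrow> almost_automorphic y" if "ode_solution \<mu> f y" for y
    using part1(2)[OF that] almost_automorphic_bounded by blast
  have formula: "(?m < 0 \<longrightarrow>
            (\<forall>t. (\<lambda>s. propagator \<mu> s t *\<^sub>C f s) integrable_on {..t} \<and>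
                 y t = integral {..t} (\<lambda>s. propagator \<mu> s t *\<^sub>C f s))) \<and>
          (?m > 0 \<longrightarrow>
            (\<forall>t. (\<lambda>s. propagator \<mu> s t *\<^sub>C f s) integrable_on {t..} \<and>
                 y t = - integral {t..} (\<lambda>s. propagator \<mu> s t *\<^sub>C f s)))"
    if "ode_solution \<mu> f y" "almost_automorphic y" for y
    using part1(2)[OF that(1)] iff[OF that(1)] that(2) by (simp add: has_integral_iff)
  have "\<exists>!y. ode_solution \<mu> f y \<and> almost_automorphic y"
  proof (rule ex_ex1I)
    show "\<exists>y. ode_solution \<mu> f y \<and> almost_automorphic y" using part1(1) iff by blast
    fix y z assume "ode_solution \<mu> f y \<and> almost_automorphic y" "ode_solution \<mu> f z \<and> almost_automorphic z"
    \<comment> \<open>The mean is nonzero, so both solutions are given by one and the same half-line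
      integral.\<close>
    with formula[of y] formula[of z] nonzero have "y t = z t" for t
      by (metis linorder_neqE)
    then show "y = z" by blast
  qed
  with iff formula show "(\<forall>y. ode_solution \<mu> f y \<longrightarrow> (bounded (range y) \<longleftrightarrow> almost_automorphic y)) \<and>
        (\<exists>!y. ode_solution \<mu> f y \<and> almost_automorphic y) \<and>
        (\<forall>y. ode_solution \<mu> f y \<and> almost_automorphic y \<longrightarrow>
          (?m < 0 \<longrightarrow>
            (\<forall>t. (\<lambda>s. propagator \<mu> s t *\<^sub>C f s) integrable_on {..t} \<and>
                 y t = integral {..t} (\<lambda>s. propagator \<mu> s t *\<^sub>C f s))) \<and>
          (?m > 0 \<longrightarrow>
            (\<forall>t. (\<lambda>s. propagator \<mu> s t *\<^sub>C f s) integrable_on {t..} \<and>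
                 y t = - integral {t..} (\<lambda>s. propagator \<mu> s t *\<^sub>C f s))))"
    by blast
next
  fix a :: "real \<Rightarrow> real"
  assume \<mu>: "\<forall>t. \<mu> t = \<i> * complex_of_real (a t)" and a: "almost_automorphic a"
    and bdd: "bounded (range (\<lambda>t. oriented_integral 0 t a))"
    and f: "almost_automorphic f" and V: "bohl_bohr_space TYPE('v)"
  have a_cont: "continuous_on UNIV a" by (rule almost_automorphic_continuous[OF a])
  have f_cont: "continuous_on UNIV f" by (rule almost_automorphic_continuous[OF f])
  have "\<mu> = (\<lambda>t. \<i> * complex_of_real (a t))" using \<mu> by blast
  then have \<mu>_cont: "continuous_on UNIV \<mu>"
    using a_cont by (auto intro!: continuous_intros)
  note prop_eq = propagator_imaginary[of \<mu> a, OF \<mu>[rule_format] a_cont]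
  have formula: "x t = propagator \<mu> 0 t *\<^sub>C x 0 + oriented_integral 0 t (\<lambda>s. propagator \<mu> s t *\<^sub>C f s)"
    if "ode_solution \<mu> f x" for x t
    using variation_of_constants[OF \<mu>_cont that, of 0 t t] by simp
  have "ode_solution \<mu> f y \<longleftrightarrow>
      (\<exists>v. \<forall>t. y t = propagator \<mu> 0 t *\<^sub>C v + oriented_integral 0 t (\<lambda>s. propagator \<mu> s t *\<^sub>C f s))" for y
  proof
    assume "ode_solution \<mu> f y"
    from formula[OF this]
    show "\<exists>v. \<forall>t. y t = propagator \<mu> 0 t *\<^sub>C v + oriented_integral 0 t (\<lambda>s. propagator \<mu> s t *\<^sub>C f s)"
      by blast
  next
    assume "\<exists>v. \<forall>t. y t = propagator \<mu> 0 t *\<^sub>C v + oriented_integral 0 t (\<lambda>s. propagator \<mu> s t *\<^sub>C f s)"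
    then obtain v where v:
      "\<And>t. y t = propagator \<mu> 0 t *\<^sub>C v + oriented_integral 0 t (\<lambda>s. propagator \<mu> s t *\<^sub>C f s)" by blast
    obtain x where x: "ode_solution \<mu> f x" "x 0 = v"
      using ode_solution_exists[OF \<mu>_cont f_cont] by metis
    \<comment> \<open>The solution starting from \<open>v\<close> at time 0 satisfies the same
      formula, so the formula itself need not be differentiated.\<close>
    have "y = x" using formula[OF x(1)] v x(2) by (intro ext) simp
    with x(1) show "ode_solution \<mu> f y" by simp
  qed
  moreover have "bounded (range y) \<longleftrightarrow> almost_automorphic y" if "ode_solution \<mu> f y" for y
    using bounded_solution_imaginary_almost_automorphic[OF _ a bdd f V that] \<mu> almost_automorphic_bounded by blast
  ultimately show "(\<forall>y. ode_solution \<mu> f y \<longrightarrow> (bounded (range y) \<longleftrightarrow> almost_automorphic y)) \<and>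
          (\<forall>y. ode_solution \<mu> f y \<longleftrightarrow>
            (\<exists>v. \<forall>t. y t =
              exp (\<i> * complex_of_real (oriented_integral 0 t a)) *\<^sub>C v +
              oriented_integral 0 t
                (\<lambda>s. exp (\<i> * complex_of_real (oriented_integral s t a)) *\<^sub>C f s)))"
    by (simp add: prop_eq)
qed

end
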